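(* Let $\Omega\subseteq\mathbb{R}^d$, $d\ge 2$, be a bounded Lipschitz domain and set $r(x):=\operatorname{dist}(x,\partial\Omega)$ for $x\in\Omega$. Then there exist constants $c_0=c_0(d,\Omega)>0$ and $h_0=h_0(\Omega)>0$ such that for every $\mathbf{u}\in X^{1,1}_{\boldsymbol\varepsilon}(\Omega)$ and almost every $x\in\Omega$ with $r(x)\le h_0$ there holds $$|\mathbf{u}(x)|\le c_0\int_{B^d_{2r(x)}(x)\cap\Omega}\frac{|\boldsymbol\varepsilon(\mathbf{u})(y)|}{|x-y|^{d-1}}\,dy .$$
   Context: $B^d_\rho(x)$ is the open ball in $\mathbb{R}^d$ of radius $\rho$ and centre $x$. $\boldsymbol\varepsilon(\mathbf{u}):=\frac12(\nabla\mathbf{u}+\nabla\mathbf{u}^\top)$ is the (distributional) symmetric gradient of a vector field $\mathbf{u}:\Omega\to\mathbb{R}^d$. $|\cdot|$ is the Euclidean norm on vectors and the Frobenius norm on matrices. The space $X^{1,1}_{\boldsymbol\varepsilon}(\Omega)$ is the closure of $C_0^\infty(\Omega)^d$ in the Banach space $\{\mathbf{u}\in L^1(\Omega)^d : \boldsymbol\varepsilon(\mathbf{u})\in L^1(\Omega)^{d\times d}\}$ with respect to the norm $\|\mathbf{u}\|_{L^1(\Omega)^d}+\|\boldsymbol\varepsilon(\mathbf{u})\|_{L^1(\Omega)^{d\times d}}$. *)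

theory Defs
  imports "HOL-Analysis.Analysis"
begin

text \<open>
  Near every boundary point, after a rotation taking the last coordinate direction to a unit
  vector \<open>e\<close>, the domain is the strict epigraph of a Lipschitz function \<open>g\<close>. Instead of \<open>d - 1\<close>
  coordinates, \<open>g\<close> takes points of the hyperplane orthogonal to \<open>e\<close>; \<open>x - (x \<bullet> e) *\<^sub>R e\<close> is the
  projection of \<open>x\<close> onto that hyperplane.
\<close>

definition lipschitz_boundary :: "'a::euclidean_space set \<Rightarrow> bool" where
  "lipschitz_boundary \<Omega> \<longleftrightarrow>
     (\<forall>p \<in> frontier \<Omega>. \<exists>\<rho> > 0. \<exists>e. \<exists>g. \<exists>L. norm e = 1 \<and> L-lipschitz_on {y. y \<bullet> e = 0} g \<and>
        \<Omega> \<inter> ball p \<rho> = {x \<in> ball p \<rho>. g (x - (x \<bullet> e) *\<^sub>R e) < x \<bullet> e})"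

definition bounded_lipschitz_domain :: "'a::euclidean_space set \<Rightarrow> bool" where
  "bounded_lipschitz_domain \<Omega> \<longleftrightarrow>
     \<Omega> \<noteq> {} \<and> open \<Omega> \<and> connected \<Omega> \<and> bounded \<Omega> \<and> lipschitz_boundary \<Omega>"

fun continuously_differentiable :: "nat \<Rightarrow> ('a::euclidean_space \<Rightarrow> real) \<Rightarrow> bool" where
  "continuously_differentiable 0 f \<longleftrightarrow> continuous_on UNIV f"
| "continuously_differentiable (Suc k) f \<longleftrightarrow>
     f differentiable_on UNIV \<and>
     (\<forall>v. continuously_differentiable k (\<lambda>x. frechet_derivative f (at x) v))"

text \<open>
  \<open>C\<^sub>0\<^sup>\<infinity>(\<Omega>)\<close>, its elements being extended by zero to the whole space, and \<open>C\<^sub>0\<^sup>\<infinity>(\<Omega>)\<^sup>d\<close>.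
\<close>

definition test_functions :: "'a::euclidean_space set \<Rightarrow> ('a \<Rightarrow> real) set" where
  "test_functions \<Omega> = {\<phi>. (\<forall>k. continuously_differentiable k \<phi>) \<and>
     compact (closure {x. \<phi> x \<noteq> 0}) \<and> closure {x. \<phi> x \<noteq> 0} \<subseteq> \<Omega>}"

definition test_fields :: "(real^'n) set \<Rightarrow> (real^'n \<Rightarrow> real^'n) set" where
  "test_fields \<Omega> = {\<phi>. \<forall>i. (\<lambda>x. \<phi> x $ i) \<in> test_functions \<Omega>}"

text \<open>
  The distributions \<open>\<partial>\<^sub>j f\<close> and \<open>\<epsilon>(u)\<^sub>i\<^sub>j = 1/2 (\<partial>\<^sub>j u\<^sub>i + \<partial>\<^sub>i u\<^sub>j)\<close> on \<open>\<Omega>\<close>, applied to a test function \<open>\<phi>\<close>.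
\<close>

definition dist_partial :: "(real^'n) set \<Rightarrow> 'n \<Rightarrow> (real^'n \<Rightarrow> real) \<Rightarrow> (real^'n \<Rightarrow> real) \<Rightarrow> real" where
  "dist_partial \<Omega> j f \<phi> =
     - (LINT x|lebesgue_on \<Omega>. f x * frechet_derivative \<phi> (at x) (axis j 1))"

definition dist_symgrad ::
  "(real^'n) set \<Rightarrow> (real^'n \<Rightarrow> real^'n) \<Rightarrow> 'n \<Rightarrow> 'n \<Rightarrow> (real^'n \<Rightarrow> real) \<Rightarrow> real" where
  "dist_symgrad \<Omega> u i j \<phi> =
     (dist_partial \<Omega> j (\<lambda>x. u x $ i) \<phi> + dist_partial \<Omega> i (\<lambda>x. u x $ j) \<phi>) / 2"

text \<open>
  The distributional symmetric gradient of \<open>u\<close> is represented by the \<open>L\<^sup>1\<close> matrix field \<open>E\<close>.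
\<close>

definition has_symgrad ::
  "(real^'n) set \<Rightarrow> (real^'n \<Rightarrow> real^'n) \<Rightarrow> (real^'n \<Rightarrow> real^'n^'n) \<Rightarrow> bool" where
  "has_symgrad \<Omega> u E \<longleftrightarrow> integrable (lebesgue_on \<Omega>) E \<and>
     (\<forall>\<phi> \<in> test_functions \<Omega>. \<forall>i j.
        dist_symgrad \<Omega> u i j \<phi> = (LINT x|lebesgue_on \<Omega>. E x $ i $ j * \<phi> x))"

text \<open>
  Some representative; two representatives agree almost everywhere on an open \<open>\<Omega>\<close>.
\<close>

definition symgrad :: "(real^'n) set \<Rightarrow> (real^'n \<Rightarrow> real^'n) \<Rightarrow> real^'n \<Rightarrow> real^'n^'n" where
  "symgrad \<Omega> u = (SOME E. has_symgrad \<Omega> u E)"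

definition E11 :: "(real^'n) set \<Rightarrow> (real^'n \<Rightarrow> real^'n) set" where
  "E11 \<Omega> = {u. integrable (lebesgue_on \<Omega>) u \<and> (\<exists>E. has_symgrad \<Omega> u E)}"

text \<open>
  The library norm on \<open>real^'n^'n\<close> is the Frobenius norm.
\<close>

definition E11_norm :: "(real^'n) set \<Rightarrow> (real^'n \<Rightarrow> real^'n) \<Rightarrow> real" where
  "E11_norm \<Omega> u =
     (LINT x|lebesgue_on \<Omega>. norm (u x)) + (LINT x|lebesgue_on \<Omega>. norm (symgrad \<Omega> u x))"

text \<open>
  The closure of \<open>C\<^sub>0\<^sup>\<infinity>(\<Omega>)\<^sup>d\<close>, on functions rather than on classes modulo null sets.
\<close>

definition X11 :: "(real^'n) set \<Rightarrow> (real^'n \<Rightarrow> real^'n) set" where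
  "X11 \<Omega> = {u \<in> E11 \<Omega>. \<forall>\<delta> > 0. \<exists>\<phi> \<in> test_fields \<Omega>. E11_norm \<Omega> (\<lambda>x. u x - \<phi> x) < \<delta>}"

end

theory Submission
  imports Defs "HOL-Computational_Algebra.Polynomial"
begin

text \<open>
  For a smooth field \<open>\<phi>\<close> with compact support in \<open>\<Omega>\<close> and a point \<open>x + w \<notin> \<Omega>\<close>, the function
  \<open>t \<mapsto> \<phi>(x + t w) \<bullet> w\<close> vanishes at \<open>t = 1\<close> and has derivative \<open>w \<bullet> \<epsilon>(\<phi>)(x + t w) w\<close>, so
  \<open>\<bar>\<phi>(x) \<bullet> w\<bar> \<le> \<bar>w\<bar>\<^sup>2 \<integral>\<^sub>0\<^sup>1 \<bar>\<epsilon>(\<phi>)(x + t w)\<bar> dt\<close>. Since the boundary is Lipschitz, \<open>B\<^bsub>2r\<^esub>(x) - \<Omega>\<close> contains a ball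
  of radius comparable to \<open>r = dist(x, \<partial>\<Omega>)\<close> when \<open>r\<close> is small. Integrating over the points \<open>x + w\<close> of
  that ball, the left-hand side dominates a multiple of \<open>\<bar>\<phi>(x)\<bar>\<close>, and the substitution \<open>y = x + t w\<close>
  turns the right-hand side into the Riesz potential. The Riesz potential is bounded on \<open>L\<^sup>1\<close> of a bounded set,
  hence the estimate passes almost everywhere to limits in the norm of \<open>X11 \<Omega>\<close>; this uses that
  representatives of the distributional symmetric gradient are unique almost everywhere.
\<close>

section \<open>Smooth bumps and the fundamental lemma of the calculus of variations\<close>

text \<open>The classical smooth function that vanishes for t \<le> 0. The polynomial factor is
  carried along so that the family is closed under differentiation; \<open>flat 1\<close> is
  exp(-1/t) itself.\<close>

definition flat :: "real poly \<Rightarrow> real \<Rightarrow> real" where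
  "flat p t = (if t > 0 then poly p (1 / t) * exp (- (1 / t)) else 0)"

lemma poly_times_exp_minus_tendsto_0:
  "((\<lambda>s::real. poly p s * exp (- s)) \<longlongrightarrow> 0) at_top"
proof -
  have "((\<lambda>s::real. \<Sum>i\<le>degree p. coeff p i * (s ^ i / exp s)) \<longlongrightarrow> (\<Sum>i\<le>degree p. coeff p i * 0)) at_top"
    by (intro tendsto_sum tendsto_mult tendsto_const tendsto_power_div_exp_0)
  then show ?thesis
    by (simp add: poly_altdef sum_distrib_right exp_minus divide_inverse mult.assoc)
qed

text \<open>With s = 1/t, differentiating p(s) exp(-s) in t gives s^2 (p(s) - p'(s)) exp(-s), and
  \<open>[:0, 0, 1:]\<close> is the polynomial s^2. At t = 0 the difference quotient from the right
  is s p(s) exp(-s), which tends to 0 as s grows.\<close>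

lemma has_real_derivative_flat:
  "(flat p has_real_derivative flat ([:0, 0, 1:] * (p - pderiv p)) t) (at t)"
proof -
  consider "t > 0" | "t < 0" | "t = 0" by linarith
  then show ?thesis
  proof cases
    case 1
    have "((\<lambda>t. poly p (1 / t) * exp (- (1 / t))) has_real_derivative
        flat ([:0, 0, 1:] * (p - pderiv p)) t) (at t)"
      using 1
      by (auto intro!: derivative_eq_intros DERIV_chain2[OF poly_DERIV] simp: flat_def field_simps)
    then show ?thesis
      by (rule DERIV_cong_ev[THEN iffD1, rotated 3])
         (use 1 in \<open>auto simp: flat_def intro: eventually_mono[OF eventually_nhds_in_open[of "{0<..}"]]\<close>)
  next
    case 2
    have "((\<lambda>t. 0) has_real_derivative flat ([:0, 0, 1:] * (p - pderiv p)) t) (at t)"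
      using 2 by (simp add: flat_def)
    then show ?thesis
      by (rule DERIV_cong_ev[THEN iffD1, rotated 3])
         (use 2 in \<open>auto simp: flat_def intro: eventually_mono[OF eventually_nhds_in_open[of "{..<0}"]]\<close>)
  next
    case 3
    have "((\<lambda>h. flat p h / h) \<longlongrightarrow> 0) (at_right 0)"
    proof -
      have "((\<lambda>s. poly ([:0, 1:] * p) s * exp (- s)) \<longlongrightarrow> 0) at_top"
        by (rule poly_times_exp_minus_tendsto_0)
      moreover have "eventually (\<lambda>s::real. poly ([:0, 1:] * p) s * exp (- s) = flat p (inverse s) / inverse s) at_top"
        using eventually_gt_at_top[of 0]
        by eventually_elim (simp add: flat_def divide_inverse)
      ultimately show ?thesis
        unfolding filterlim_at_right_to_top by (rule Lim_transform_eventually)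
    qed
    moreover have "((\<lambda>h. flat p h / h) \<longlongrightarrow> 0) (at_left 0)"
      by (rule tendsto_eventually) (auto simp: flat_def eventually_at_filter)
    ultimately have "((\<lambda>h. flat p h / h) \<longlongrightarrow> 0) (at 0)"
      by (rule filterlim_split_at_real[rotated])
    then show ?thesis
      using 3 by (simp add: flat_def has_field_derivative_iff)
  qed
qed

text \<open>Derivatives of \<open>p(1/t) exp(-1/t)\<close> have the same form, so the algebra generated by these functions is
  closed under directional derivatives and consists of smooth functions.\<close>

inductive_set flat_algebra :: "('a::euclidean_space \<Rightarrow> real) set" where
  const: "(\<lambda>x. c) \<in> flat_algebra"
| flat: "(\<lambda>x. flat p (x \<bullet> w + c)) \<in> flat_algebra"
| add: "f \<in> flat_algebra \<Longrightarrow> g \<in> flat_algebra \<Longrightarrow> (\<lambda>x. f x + g x) \<in> flat_algebra"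
| mult: "f \<in> flat_algebra \<Longrightarrow> g \<in> flat_algebra \<Longrightarrow> (\<lambda>x. f x * g x) \<in> flat_algebra"

text \<open>The derivative is indexed by the direction first, so that each directional derivative is
  itself a member of the algebra. This is what an induction on the order of smoothness
  needs.\<close>

lemma flat_algebra_derivative:
  assumes "f \<in> flat_algebra"
  shows "\<exists>f'. (\<forall>x. (f has_derivative (\<lambda>v. f' v x)) (at x)) \<and> (\<forall>v. f' v \<in> flat_algebra)"
  using assms
proof induction
  case (const c)
  then show ?case
    by (intro exI[of _ "\<lambda>v x. 0"]) (auto intro: flat_algebra.const)
next
  case (flat p w c)
  have "((\<lambda>x. flat p (x \<bullet> w + c)) has_derivative
      (\<lambda>v. flat ([:0, 0, 1:] * (p - pderiv p)) (x \<bullet> w + c) * (v \<bullet> w))) (at x)" for x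
    by (rule has_derivative_compose[OF _ has_real_derivative_flat[unfolded has_field_derivative_def],
          of "\<lambda>x. x \<bullet> w + c" "\<lambda>v. v \<bullet> w"])
       (auto intro!: derivative_eq_intros)
  then show ?case
    by (intro exI[of _ "\<lambda>v x. flat ([:0, 0, 1:] * (p - pderiv p)) (x \<bullet> w + c) * (v \<bullet> w)"])
       (auto intro: flat_algebra.mult flat_algebra.flat flat_algebra.const)
next
  case (add f g)
  then obtain f' g' where "\<And>x. (f has_derivative (\<lambda>v. f' v x)) (at x)" "\<And>v. f' v \<in> flat_algebra"
    "\<And>x. (g has_derivative (\<lambda>v. g' v x)) (at x)" "\<And>v. g' v \<in> flat_algebra" by blast
  then show ?case
    by (intro exI[of _ "\<lambda>v x. f' v x + g' v x"])
       (auto intro: flat_algebra.add has_derivative_add)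
next
  case (mult f g)
  then obtain f' g' where *: "\<And>x. (f has_derivative (\<lambda>v. f' v x)) (at x)" "\<And>v. f' v \<in> flat_algebra"
    "\<And>x. (g has_derivative (\<lambda>v. g' v x)) (at x)" "\<And>v. g' v \<in> flat_algebra" by blast
  with mult.hyps show ?case
    by (intro exI[of _ "\<lambda>v x. f x * g' v x + f' v x * g x"])
       (auto intro!: flat_algebra.add flat_algebra.mult has_derivative_mult)
qed

lemma flat_algebra_continuously_differentiable:
  "f \<in> flat_algebra \<Longrightarrow> continuously_differentiable k f"
proof (induction k arbitrary: f)
  case 0
  then show ?case
    using flat_algebra_derivative[OF 0]
    by (auto intro!: continuous_at_imp_continuous_on intro: has_derivative_continuous)
next
  case (Suc k)
  from flat_algebra_derivative[OF Suc.prems]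
  obtain f' where f': "\<And>x. (f has_derivative (\<lambda>v. f' v x)) (at x)" "\<And>v. f' v \<in> flat_algebra"
    by blast
  have "frechet_derivative f (at x) v = f' v x" for x v
    using frechet_derivative_at[OF f'(1)[of x]] by metis
  then show ?case
    using f' Suc.IH by (auto simp: differentiable_on_def differentiable_def intro: has_derivative_at_withinI)
qed

lemma flat_algebra_prod:
  assumes "finite I" "\<And>i. i \<in> I \<Longrightarrow> f i \<in> flat_algebra"
  shows "(\<lambda>x. \<Prod>i\<in>I. f i x) \<in> flat_algebra"
  using assms by (induction) (auto intro: flat_algebra.const flat_algebra.mult)

section \<open>Smooth bumps converging pointwise to the indicator of an open box\<close>

definition box_bump :: "'a::euclidean_space \<Rightarrow> 'a \<Rightarrow> nat \<Rightarrow> 'a \<Rightarrow> real" where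
  "box_bump a b n x = (\<Prod>i\<in>Basis. flat 1 (real (Suc n) * (x \<bullet> i - a \<bullet> i)) * flat 1 (real (Suc n) * (b \<bullet> i - x \<bullet> i)))"

lemma flat_1_bounds: "0 \<le> flat 1 t" "flat 1 t \<le> 1"
  by (auto simp: flat_def)

lemma flat_1_tendsto:
  assumes "t > 0"
  shows "(\<lambda>n. flat 1 (real (Suc n) * t)) \<longlonglongrightarrow> 1"
proof -
  have "(\<lambda>n. exp (- (inverse (real (Suc n)) / t))) \<longlonglongrightarrow> exp (- (0 / t))"
    using assms by (intro tendsto_intros LIMSEQ_inverse_real_of_nat) auto
  then show ?thesis
    using assms by (simp add: flat_def divide_inverse mult.commute)
qed

lemma box_bump_bounds: "0 \<le> box_bump a b n x" "box_bump a b n x \<le> 1"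
  unfolding box_bump_def
  by (auto intro!: prod_nonneg prod_le_1 mult_le_one mult_nonneg_nonneg flat_1_bounds simp del: of_nat_Suc)

lemma box_bump_eq_0: "x \<notin> box a b \<Longrightarrow> box_bump a b n x = 0"
  unfolding box_bump_def flat_def box_def by (auto intro!: bexI simp: zero_less_mult_iff)

lemma box_bump_tendsto: "(\<lambda>n. box_bump a b n x) \<longlonglongrightarrow> indicator (box a b) x"
proof (cases "x \<in> box a b")
  case True
  have "(\<lambda>n. box_bump a b n x) \<longlonglongrightarrow> (\<Prod>i\<in>(Basis::'a set). 1 * 1)"
    unfolding box_bump_def
    using True by (intro tendsto_prod tendsto_mult flat_1_tendsto) (auto simp: box_def)
  with True show ?thesis by simp
qed (simp add: box_bump_eq_0)

lemma box_bump_test_function: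
  assumes "cbox a b \<subseteq> \<Omega>"
  shows "box_bump a b n \<in> test_functions \<Omega>"
proof -
  \<comment> \<open>Each factor is brought to the form \<open>flat\<close> of an affine function x
    \<bullet> w + c, which is the shape of the generators of \<open>flat_algebra\<close>.\<close>
  have "(\<lambda>x. flat 1 (x \<bullet> (real (Suc n) *\<^sub>R i) + - (real (Suc n) * (a \<bullet> i))) *
        flat 1 (x \<bullet> (- real (Suc n) *\<^sub>R i) + real (Suc n) * (b \<bullet> i))) \<in> flat_algebra" for i :: 'a
    by (intro flat_algebra.mult flat_algebra.flat)
  also have "(\<lambda>i::'a. (\<lambda>x. flat 1 (x \<bullet> (real (Suc n) *\<^sub>R i) + - (real (Suc n) * (a \<bullet> i))) *
        flat 1 (x \<bullet> (- real (Suc n) *\<^sub>R i) + real (Suc n) * (b \<bullet> i)))) =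
     (\<lambda>i x. flat 1 (real (Suc n) * (x \<bullet> i - a \<bullet> i)) * flat 1 (real (Suc n) * (b \<bullet> i - x \<bullet> i)))"
    by (simp add: algebra_simps)
  finally have "box_bump a b n \<in> flat_algebra"
    unfolding box_bump_def[abs_def] by (intro flat_algebra_prod) auto
  moreover have "closure {x. box_bump a b n x \<noteq> 0} \<subseteq> cbox a b"
    using box_bump_eq_0 by (intro closure_minimal closed_cbox) (use box_subset_cbox in blast)
  moreover from this have "compact (closure {x. box_bump a b n x \<noteq> 0})"
    by (meson bounded_cbox bounded_subset closed_closure compact_eq_bounded_closed)
  ultimately show ?thesis
    using assms by (auto simp: test_functions_def flat_algebra_continuously_differentiable)
qed

text \<open>A Dynkin system argument. Open boxes are stable under intersection and generate the
  Borel sets, and vanishing of the integral passes to complements and to countable disjoint unions.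
  The complement step uses the total integral, which is assumed separately because the whole space
  is not a box.\<close>

lemma AE_eq_0_if_box_integrals_0:
  fixes g :: "'a::euclidean_space \<Rightarrow> real"
  assumes g: "integrable lborel g"
    and box: "\<And>c d. (LINT x:box c d|lborel. g x) = 0"
    and tot: "(LINT x|lborel. g x) = 0"
  shows "AE x in lborel. g x = 0"
proof -
  have si: "set_integrable lborel A g" if "A \<in> sets borel" for A
    unfolding set_integrable_def using that g by (intro integrable_mult_indicator) auto
  have "(LINT x:A|lborel. g x) = 0" if A: "A \<in> sets borel" for A
  proof -
    have "Int_stable (range (\<lambda>(a, b). box a b :: 'a set))"
      by (force simp: Int_stable_def box_Int_box)
    moreover have "range (\<lambda>(a, b). box a b :: 'a set) \<subseteq> Pow UNIV" by simp
    moreover have "A \<in> sigma_sets UNIV (range (\<lambda>(a, b). box a b))"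
      using A unfolding borel_eq_box by simp
    ultimately show ?thesis
    proof (induction rule: sigma_sets_induct_disjoint)
      case (basic A)
      then show ?case using box by auto
    next
      case empty
      then show ?case by (simp add: set_lebesgue_integral_def)
    next
      case (compl A)
      then have [measurable]: "A \<in> sets borel" by (simp add: borel_eq_box)
      have "(LINT x:A \<union> (UNIV - A)|lborel. g x) = (LINT x:A|lborel. g x) + (LINT x:(UNIV - A)|lborel. g x)"
        by (intro set_integral_Un si) auto
      with compl tot show ?case by (simp add: set_lebesgue_integral_def)
    next
      case (union A)
      then have [measurable]: "A i \<in> sets borel" for i by (auto simp: borel_eq_box)
      have "(LINT x:(\<Union>i. A i)|lborel. g x) = (\<Sum>i. (LINT x:(A i)|lborel. g x))"
        using union by (intro lebesgue_integral_countable_add si) (auto simp: disjoint_family_on_def)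
      with union show ?case by simp
    qed
  qed
  then show ?thesis
    using g by (intro density_unique_real) (auto simp: set_lebesgue_integral_def)
qed

text \<open>Bumps recover the integral of f over every box whose closure lies in
  \<open>\<Omega>\<close>. This forces f to vanish almost everywhere on each such closed box, and
  countably many of them cover \<open>\<Omega>\<close>.\<close>

lemma fundamental_lemma_calculus_of_variations:
  fixes f :: "'a::euclidean_space \<Rightarrow> real"
  assumes \<Omega>: "open \<Omega>" and f: "integrable (lebesgue_on \<Omega>) f"
    and zero: "\<And>\<phi>. \<phi> \<in> test_functions \<Omega> \<Longrightarrow> (LINT x|lebesgue_on \<Omega>. f x * \<phi> x) = 0"
  shows "AE x in lebesgue_on \<Omega>. f x = 0"
proof -
  have [measurable]: "\<Omega> \<in> sets borel" using \<Omega> by simp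
  have fi: "integrable lebesgue (\<lambda>x. indicator \<Omega> x *\<^sub>R f x)"
    using f by (subst (asm) integrable_restrict_space) auto
  then have "(\<lambda>x. indicator \<Omega> x *\<^sub>R f x) \<in> borel_measurable lebesgue" by auto
  then obtain g where g[measurable]: "g \<in> borel_measurable lborel"
    and ae: "AE x in lborel. indicator \<Omega> x *\<^sub>R f x = g x"
    using completion_ex_borel_measurable_real by blast
  then have ael: "AE x in lebesgue. indicator \<Omega> x *\<^sub>R f x = g x"
    by (simp add: AE_completion)
  have "integrable lebesgue g"
    by (rule integrable_cong_AE_imp[OF fi]) (use ael in \<open>auto intro: measurable_completion\<close>)
  then have gi: "integrable lborel g" by (simp add: integrable_completion)
  have gzero: "(LINT x|lborel. g x * \<phi> x) = 0" if \<phi>: "\<phi> \<in> test_functions \<Omega>" for \<phi>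
  proof -
    have "continuous_on UNIV \<phi>"
      using \<phi> by (force simp: test_functions_def dest: spec[of _ 0])
    then have [measurable]: "\<phi> \<in> borel_measurable borel" by (rule borel_measurable_continuous_onI)
    have "(LINT x|lborel. g x * \<phi> x) = (LINT x|lebesgue. g x * \<phi> x)"
      by (subst integral_completion) auto
    also have "\<dots> = (LINT x|lebesgue. indicator \<Omega> x *\<^sub>R (f x * \<phi> x))"
    proof (rule integral_cong_AE)
      have "(\<lambda>x. (indicator \<Omega> x *\<^sub>R f x) * \<phi> x) \<in> borel_measurable lebesgue"
        using fi by (intro borel_measurable_times) (auto intro: measurable_completion)
      then show "(\<lambda>x. indicator \<Omega> x *\<^sub>R (f x * \<phi> x)) \<in> borel_measurable lebesgue"
        by (simp add: mult.assoc)
      show "AE x in lebesgue. g x * \<phi> x = indicator \<Omega> x *\<^sub>R (f x * \<phi> x)"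
        using ael by eventually_elim (metis mult_scaleR_left)
    qed (auto intro: measurable_completion)
    also have "\<dots> = 0"
      using zero[OF \<phi>] by (subst (asm) integral_restrict_space) auto
    finally show ?thesis .
  qed
  \<comment> \<open>The bumps are test functions because their support lies in the closed box. They
    are bounded by 1, so \<bar>g\<bar> dominates and the integrals converge to the one over the open
    box.\<close>
  have gbox: "(LINT x:box a b|lborel. g x) = 0" if ab: "cbox a b \<subseteq> \<Omega>" for a b
  proof -
    have [measurable]: "box_bump a b n \<in> borel_measurable borel" for n
      using box_bump_test_function[OF ab, of n]
      by (intro borel_measurable_continuous_onI) (force simp: test_functions_def dest: spec[of _ 0])
    have "(\<lambda>n. LINT x|lborel. g x * box_bump a b n x) \<longlonglongrightarrow> (LINT x|lborel. g x * indicator (box a b) x)"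
    proof (rule integral_dominated_convergence[where w = "\<lambda>x. norm (g x)"])
      show "AE x in lborel. norm (g x * box_bump a b n x) \<le> norm (g x)" for n
        by (auto simp: abs_mult box_bump_bounds intro!: mult_left_le)
      show "AE x in lborel. (\<lambda>n. g x * box_bump a b n x) \<longlonglongrightarrow> g x * indicator (box a b) x"
        by (intro AE_I2 tendsto_intros box_bump_tendsto)
    qed (use gi in auto)
    moreover have "(LINT x|lborel. g x * box_bump a b n x) = 0" for n
      by (rule gzero[OF box_bump_test_function[OF ab]])
    ultimately have "(LINT x|lborel. g x * indicator (box a b) x) = 0"
      by (simp add: LIMSEQ_const_iff)
    then show ?thesis by (simp add: set_lebesgue_integral_def mult.commute)
  qed
  have aebox: "AE x in lborel. x \<in> cbox a b \<longrightarrow> g x = 0" if ab: "cbox a b \<subseteq> \<Omega>" for a b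
  proof -
    have "AE x in lborel. indicator (box a b) x *\<^sub>R g x = 0"
    proof (rule AE_eq_0_if_box_integrals_0)
      show "integrable lborel (\<lambda>x. indicator (box a b) x *\<^sub>R g x)"
        using gi by (intro integrable_mult_indicator) auto
      show "(LINT x|lborel. indicator (box a b) x *\<^sub>R g x) = 0"
        using gbox[OF ab] by (simp add: set_lebesgue_integral_def)
      fix c d
      \<comment> \<open>Integrating the cut-off function over a box amounts to integrating g over
        the intersection of two boxes, which is again a box with closure inside
        \<open>\<Omega>\<close>.\<close>
      obtain a' b' where eq: "box a b \<inter> box c d = box a' b'" "cbox a b \<inter> cbox c d = cbox a' b'"
        unfolding box_Int_box Int_interval by blast
      have "(LINT x:box a' b'|lborel. g x) = 0"
        using ab eq by (intro gbox) auto
      then show "(LINT x:box c d|lborel. indicator (box a b) x *\<^sub>R g x) = 0"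
        by (simp add: set_lebesgue_integral_def eq(1)[symmetric] indicator_inter_arith mult_ac)
    qed
    moreover have "AE x in lborel. x \<notin> cbox a b - box a b"
    proof -
      have "negligible (cbox a b - box a b)" by (rule negligible_frontier_interval)
      then have "cbox a b - box a b \<in> null_sets lborel"
        by (simp add: negligible_iff_null_sets null_sets_completion_iff)
      then show ?thesis by (rule AE_not_in)
    qed
    ultimately show ?thesis by eventually_elim auto
  qed
  \<comment> \<open>Countability of the cover lets the exceptional null sets of the single boxes be
    collected into one.\<close>
  obtain \<D> where \<D>: "countable \<D>" "\<D> \<subseteq> Pow \<Omega>" "\<And>X. X \<in> \<D> \<Longrightarrow> \<exists>a b. X = cbox a b" "\<Union>\<D> = \<Omega>"
    using open_countable_Union_open_cbox[OF \<Omega>] by metis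
  have "AE x in lborel. \<forall>X\<in>\<D>. x \<in> X \<longrightarrow> g x = 0"
  proof (subst AE_ball_countable[OF \<D>(1)], intro ballI)
    fix X assume X: "X \<in> \<D>"
    then obtain a b where "X = cbox a b" using \<D>(3) by blast
    with X \<D>(2) aebox[of a b] show "AE x in lborel. x \<in> X \<longrightarrow> g x = 0" by auto
  qed
  with ae have "AE x in lborel. x \<in> \<Omega> \<longrightarrow> f x = 0"
  proof eventually_elim
    case (elim x)
    then show ?case
      using \<D>(4) by (cases "x \<in> \<Omega>") auto
  qed
  then have "AE x in lebesgue. x \<in> \<Omega> \<longrightarrow> f x = 0" by (rule AE_completion)
  then show ?thesis by (subst AE_restrict_space_iff) auto
qed

section \<open>Integration by parts\<close>

lemma test_functionD:
  assumes "\<phi> \<in> test_functions \<Omega>"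
  shows test_function_continuous: "continuous_on UNIV \<phi>"
    and test_function_has_derivative: "(\<phi> has_derivative frechet_derivative \<phi> (at x)) (at x)"
    and test_function_derivative_continuous: "continuous_on UNIV (\<lambda>x. frechet_derivative \<phi> (at x) v)"
proof -
  have "continuously_differentiable 0 \<phi>" "continuously_differentiable (Suc 0) \<phi>"
    using assms unfolding test_functions_def by blast+
  then show "continuous_on UNIV \<phi>" "(\<phi> has_derivative frechet_derivative \<phi> (at x)) (at x)"
     "continuous_on UNIV (\<lambda>x. frechet_derivative \<phi> (at x) v)"
    by (auto simp: differentiable_on_def frechet_derivative_works)
qed

lemma test_function_support:
  assumes "\<phi> \<in> test_functions \<Omega>"
  obtains K where "compact K" "K \<subseteq> \<Omega>" "\<And>x. x \<notin> K \<Longrightarrow> \<phi> x = 0"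
    "\<And>x v. x \<notin> K \<Longrightarrow> frechet_derivative \<phi> (at x) v = 0"
proof
  let ?K = "closure {x. \<phi> x \<noteq> 0}"
  show "compact ?K" "?K \<subseteq> \<Omega>" using assms by (auto simp: test_functions_def)
  show zero: "\<phi> x = 0" if "x \<notin> ?K" for x using that closure_subset[of "{x. \<phi> x \<noteq> 0}"] by auto
  show "frechet_derivative \<phi> (at x) v = 0" if x: "x \<notin> ?K" for x v
  proof -
    have "((\<lambda>x. 0) has_derivative frechet_derivative \<phi> (at x)) (at x)"
    proof (rule has_derivative_transform_within_open[OF test_function_has_derivative[OF assms]])
      show "open (- ?K)" "x \<in> - ?K" using x by auto
      show "\<phi> y = 0" if "y \<in> - ?K" for y using that by (intro zero) simp
    qed
    then have "frechet_derivative \<phi> (at x) = (\<lambda>v. 0)"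
      by (rule has_derivative_unique[OF _ has_derivative_const])
    then show ?thesis by simp
  qed
qed

section \<open>Bounds and integrability for continuous functions\<close>

lemma continuous_compact_support_bounded:
  fixes f :: "'a::topological_space \<Rightarrow> 'b::real_normed_vector"
  assumes "continuous_on UNIV f" "compact K" "\<And>x. x \<notin> K \<Longrightarrow> f x = 0"
  obtains B where "0 \<le> B" "\<And>x. norm (f x) \<le> B"
proof -
  have "bounded (f ` K)"
    using assms by (meson compact_continuous_image compact_imp_bounded continuous_on_subset subset_UNIV)
  then obtain B where "\<And>x. x \<in> K \<Longrightarrow> norm (f x) \<le> B" by (auto simp: bounded_iff)
  then have "norm (f x) \<le> max 0 B" for x
    using assms(3)[of x] by (cases "x \<in> K") (auto simp: le_max_iff_disj)
  with that[of "max 0 B"] show ?thesis by auto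
qed

lemma continuous_compact_support_integrable:
  fixes f :: "'a::euclidean_space \<Rightarrow> real"
  assumes "continuous_on UNIV f" "compact K" "\<And>x. x \<notin> K \<Longrightarrow> f x = 0"
  shows "integrable lborel f"
proof -
  have "integrable lborel (\<lambda>x. indicator K x *\<^sub>R f x)"
    using assms by (intro borel_integrable_compact) (auto intro: continuous_on_subset)
  also have "(\<lambda>x. indicator K x *\<^sub>R f x) = f"
    using assms(3) by (force simp: indicator_def)
  finally show ?thesis .
qed

text \<open>A bridge between the definitions, which integrate over \<open>lebesgue_on\<close>, and
  translation, product and limit arguments carried out over \<open>lborel\<close>.\<close>

lemma lebesgue_on_eq_lborel:
  fixes h :: "'a::euclidean_space \<Rightarrow> real"
  assumes [measurable]: "h \<in> borel_measurable borel" "\<Omega> \<in> sets borel" and zero: "\<And>x. x \<notin> \<Omega> \<Longrightarrow> h x = 0"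
  shows "(LINT x|lebesgue_on \<Omega>. h x) = (LINT x|lborel. h x)"
    and "integrable (lebesgue_on \<Omega>) h \<longleftrightarrow> integrable lborel h"
proof -
  have eq: "(\<lambda>x. indicator \<Omega> x *\<^sub>R h x) = h"
    using zero by (force simp: indicator_def)
  show "(LINT x|lebesgue_on \<Omega>. h x) = (LINT x|lborel. h x)"
    by (subst integral_restrict_space) (auto simp: eq[simplified] integral_completion)
  show "integrable (lebesgue_on \<Omega>) h \<longleftrightarrow> integrable lborel h"
    by (subst integrable_restrict_space) (auto simp: eq[simplified] integrable_completion)
qed

lemma borel_measurable_lebesgue_on:
  "f \<in> borel_measurable borel \<Longrightarrow> f \<in> borel_measurable (lebesgue_on S)"
  by (intro measurable_restrict_space1 measurable_completion) simp

lemma integrable_mult_bounded_continuous: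
  fixes f :: "'a::euclidean_space \<Rightarrow> real"
  assumes f: "integrable (lebesgue_on \<Omega>) f" and "continuous_on UNIV \<psi>" "\<And>x. norm (\<psi> x) \<le> B"
  shows "integrable (lebesgue_on \<Omega>) (\<lambda>x. f x * \<psi> x)"
proof (rule Bochner_Integration.integrable_bound)
  show "integrable (lebesgue_on \<Omega>) (\<lambda>x. B * f x)" using f by simp
  have "\<psi> \<in> borel_measurable (lebesgue_on \<Omega>)"
    by (intro borel_measurable_lebesgue_on borel_measurable_continuous_onI assms)
  then show "(\<lambda>x. f x * \<psi> x) \<in> borel_measurable (lebesgue_on \<Omega>)"
    using f by simp
  have "0 \<le> B" using assms(3)[of 0] norm_ge_zero order_trans by blast
  then show "AE x in lebesgue_on \<Omega>. norm (f x * \<psi> x) \<le> norm (B * f x)"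
    using assms(3) by (intro AE_I2) (auto simp: abs_mult mult.commute intro: mult_right_mono)
qed

text \<open>By translation invariance every difference quotient of g in direction v has integral
  zero. Dominated convergence carries this over to the derivative.\<close>

lemma integral_directional_derivative_eq_0:
  fixes g :: "'a::euclidean_space \<Rightarrow> real"
  assumes der: "\<And>x. (g has_derivative g' x) (at x)"
    and cont: "continuous_on UNIV (\<lambda>x. g' x v)"
    and K: "compact K" "\<And>x. x \<notin> K \<Longrightarrow> g x = 0" "\<And>x. x \<notin> K \<Longrightarrow> g' x v = 0"
  shows "(LINT x|lborel. g' x v) = 0"
proof -
  have gc: "continuous_on UNIV g"
    using der by (auto intro!: continuous_at_imp_continuous_on intro: has_derivative_continuous)
  then have [measurable]: "g \<in> borel_measurable borel" "(\<lambda>x. g' x v) \<in> borel_measurable borel"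
    using cont by (auto intro: borel_measurable_continuous_onI)
  have gi: "integrable lborel g" by (rule continuous_compact_support_integrable[OF gc K(1,2)])
  obtain M where M: "0 \<le> M" "\<And>x. norm (g' x v) \<le> M"
    using continuous_compact_support_bounded[OF cont K(1,3)] by blast
  obtain R where R: "\<And>x. x \<in> K \<Longrightarrow> norm x \<le> R"
    using K(1) compact_imp_bounded by (metis bounded_iff)
  define q where "q n x = real (Suc n) * (g (inverse (real (Suc n)) *\<^sub>R v + x) - g x)" for n x
  have lip: "\<bar>g (h *\<^sub>R v + x) - g x\<bar> \<le> M * h" if "h \<ge> 0" for h x
  proof -
    have "((\<lambda>t. g (t *\<^sub>R v + x)) has_derivative (\<lambda>s. g' (t *\<^sub>R v + x) (s *\<^sub>R v))) (at t within {0..h})" for t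
      by (rule has_derivative_compose[OF _ der]) (auto intro!: derivative_eq_intros)
    moreover have "(\<lambda>s. g' (t *\<^sub>R v + x) (s *\<^sub>R v)) = (\<lambda>s. s *\<^sub>R g' (t *\<^sub>R v + x) v)" for t
      using has_derivative_linear[OF der] by (simp add: linear_cmul)
    ultimately have "norm (g (h *\<^sub>R v + x) - g (0 *\<^sub>R v + x)) \<le> M * norm (h - 0)"
      using M that
      by (intro differentiable_bound[where S = "{0..h}" and f = "\<lambda>t. g (t *\<^sub>R v + x)"])
         (auto intro!: onorm_bound simp: abs_mult mult.commute[of M] mult_left_mono)
    with that show ?thesis by simp
  qed
  \<comment> \<open>The step sizes are at most 1. Outside the ball of radius R + \<bar>v\<bar>, both
    the point and its translate therefore miss K and the quotient is 0; inside, the mean value bound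
    M applies.\<close>
  have "(\<lambda>n. LINT x|lborel. q n x) \<longlonglongrightarrow> (LINT x|lborel. g' x v)"
  proof (rule integral_dominated_convergence[where w = "\<lambda>x. indicator (cball 0 (R + norm v)) x *\<^sub>R M"])
    show "q n \<in> borel_measurable lborel" for n unfolding q_def by measurable
    show "integrable lborel (\<lambda>x. indicator (cball 0 (R + norm v)) x *\<^sub>R M)"
      by (intro borel_integrable_compact) auto
    show "AE x in lborel. norm (q n x) \<le> indicator (cball 0 (R + norm v)) x *\<^sub>R M" for n
    proof (intro AE_I2)
      fix x :: 'a
      let ?h = "inverse (real (Suc n))"
      have h: "0 < ?h" "?h \<le> 1" by (auto simp: inverse_le_1_iff)
      show "norm (q n x) \<le> indicator (cball 0 (R + norm v)) x *\<^sub>R M"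
      proof (cases "x \<in> cball 0 (R + norm v)")
        case True
        have "norm (q n x) = real (Suc n) * \<bar>g (?h *\<^sub>R v + x) - g x\<bar>"
          by (simp add: q_def abs_mult)
        also have "\<dots> \<le> real (Suc n) * (M * ?h)"
          by (intro mult_left_mono lip) auto
        also have "\<dots> = M" by simp
        finally show ?thesis using True by simp
      next
        case False
        have "norm x \<le> norm (?h *\<^sub>R v + x) + norm (?h *\<^sub>R v)"
          by (metis add.commute add_diff_cancel norm_triangle_ineq4)
        moreover have "norm (?h *\<^sub>R v) \<le> norm v" using h by (simp add: mult_left_le_one_le)
        ultimately have "?h *\<^sub>R v + x \<notin> K" "x \<notin> K"
          using False R[of x] R[of "?h *\<^sub>R v + x"] norm_ge_zero[of v] by (auto simp del: of_nat_Suc)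
        then show ?thesis using K(2) False by (simp add: q_def)
      qed
    qed
    show "AE x in lborel. (\<lambda>n. q n x) \<longlonglongrightarrow> g' x v"
    proof (intro AE_I2)
      fix x :: 'a
      have "((\<lambda>t. g (x + t *\<^sub>R v)) has_derivative (\<lambda>s. g' x (s *\<^sub>R v))) (at 0)"
        by (rule has_derivative_compose[where g = g and f = "\<lambda>t. x + t *\<^sub>R v"])
           (use der in \<open>auto intro!: derivative_eq_intros\<close>)
      moreover have "(\<lambda>s. g' x (s *\<^sub>R v)) = (\<lambda>s. g' x v * s)"
        using has_derivative_linear[OF der] by (simp add: linear_cmul mult.commute)
      ultimately have "((\<lambda>t. g (x + t *\<^sub>R v)) has_field_derivative g' x v) (at 0)"
        by (simp add: has_field_derivative_def)
      then have "((\<lambda>h. (g (x + h *\<^sub>R v) - g x) / h) \<longlongrightarrow> g' x v) (at 0)"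
        by (simp add: DERIV_def)
      moreover have "filterlim (\<lambda>n. inverse (real (Suc n))) (at 0) sequentially"
        by (auto simp: filterlim_at LIMSEQ_inverse_real_of_nat simp del: of_nat_Suc)
      ultimately have "(\<lambda>n. (g (x + inverse (real (Suc n)) *\<^sub>R v) - g x) / inverse (real (Suc n))) \<longlonglongrightarrow> g' x v"
        by (rule filterlim_compose)
      then show "(\<lambda>n. q n x) \<longlonglongrightarrow> g' x v"
        by (simp add: q_def[abs_def] divide_inverse add.commute mult.commute)
    qed
  qed auto
  moreover have "(LINT x|lborel. q n x) = 0" for n
  proof -
    have shift: "(LINT x|lborel. g (c + x)) = (LINT x|lborel. g x)" "integrable lborel (\<lambda>x. g (c + x))" for c
    proof -
      have "(LINT x|lborel. g x) = (LINT x|distr lborel borel ((+) c). g x)"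
        by (simp add: lborel_distr_plus)
      then show "(LINT x|lborel. g (c + x)) = (LINT x|lborel. g x)" by (subst (asm) integral_distr) auto
      have "integrable (distr lborel borel ((+) c)) g"
        using gi by (simp add: lborel_distr_plus)
      then show "integrable lborel (\<lambda>x. g (c + x))" by (subst (asm) integrable_distr_eq) auto
    qed
    show ?thesis
      unfolding q_def by (subst integral_mult_right_zero) (simp add: shift gi)
  qed
  ultimately show ?thesis by (simp add: LIMSEQ_const_iff)
qed

text \<open>The product has compact support, so the integral of its directional derivative is zero;
  the product rule splits that integral into the two terms.\<close>

lemma integration_by_parts_test_functions:
  assumes \<phi>: "\<phi> \<in> test_functions \<Omega>" and \<psi>: "\<psi> \<in> test_functions \<Omega>"
  shows "(LINT x|lborel. \<phi> x * frechet_derivative \<psi> (at x) v) =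
    - (LINT x|lborel. frechet_derivative \<phi> (at x) v * \<psi> x)"
proof -
  obtain K where K: "compact K" "\<And>x. x \<notin> K \<Longrightarrow> \<phi> x = 0" "\<And>x v. x \<notin> K \<Longrightarrow> frechet_derivative \<phi> (at x) v = 0"
    using test_function_support[OF \<phi>] by metis
  note c = test_function_continuous[OF \<phi>] test_function_continuous[OF \<psi>]
     test_function_derivative_continuous[OF \<phi>, of v] test_function_derivative_continuous[OF \<psi>, of v]
  have "(LINT x|lborel. (\<lambda>x v. \<phi> x * frechet_derivative \<psi> (at x) v + frechet_derivative \<phi> (at x) v * \<psi> x) x v) = 0"
    using K c
    by (intro integral_directional_derivative_eq_0[where g = "\<lambda>x. \<phi> x * \<psi> x" and K = K]
        has_derivative_mult test_function_has_derivative[OF \<phi>] test_function_has_derivative[OF \<psi>])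
       (auto intro!: continuous_intros)
  moreover have "integrable lborel (\<lambda>x. \<phi> x * frechet_derivative \<psi> (at x) v)"
    using K c by (intro continuous_compact_support_integrable[of _ K]) (auto intro!: continuous_intros)
  moreover have "integrable lborel (\<lambda>x. frechet_derivative \<phi> (at x) v * \<psi> x)"
    using K c by (intro continuous_compact_support_integrable[of _ K]) (auto intro!: continuous_intros)
  ultimately show ?thesis by simp
qed

section \<open>Uniqueness of the symmetric gradient\<close>

text \<open>A concrete pointwise representative for smooth fields, which is continuous and can be
  evaluated along segments, whereas \<open>symgrad\<close> is an arbitrary choice.\<close>

definition classical_symgrad :: "(real^'n \<Rightarrow> real^'n) \<Rightarrow> real^'n \<Rightarrow> real^'n^'n" where
  "classical_symgrad \<phi> x = (\<chi> i j. (frechet_derivative (\<lambda>x. \<phi> x $ i) (at x) (axis j 1) +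
     frechet_derivative (\<lambda>x. \<phi> x $ j) (at x) (axis i 1)) / 2)"

lemma integrable_vec_nth:
  fixes f :: "'a \<Rightarrow> ('b::euclidean_space)^'n"
  shows "integrable M f \<Longrightarrow> integrable M (\<lambda>x. f x $ i)"
  by (rule integrable_bounded_linear[OF bounded_linear_vec_nth])

lemma integrable_mult_test_function:
  assumes "integrable (lebesgue_on \<Omega>) f" "\<psi> \<in> test_functions \<Omega>"
  shows "integrable (lebesgue_on \<Omega>) (\<lambda>x. f x * \<psi> x)"
    and "integrable (lebesgue_on \<Omega>) (\<lambda>x. f x * frechet_derivative \<psi> (at x) v)"
proof -
  obtain K where K: "compact K" "\<And>x. x \<notin> K \<Longrightarrow> \<psi> x = 0" "\<And>x v. x \<notin> K \<Longrightarrow> frechet_derivative \<psi> (at x) v = 0"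
    using test_function_support[OF assms(2)] by metis
  note c = test_function_continuous[OF assms(2)] test_function_derivative_continuous[OF assms(2), of v]
  obtain B where "\<And>x. norm (\<psi> x) \<le> B"
    using continuous_compact_support_bounded[OF c(1) K(1,2)] by metis
  then show "integrable (lebesgue_on \<Omega>) (\<lambda>x. f x * \<psi> x)"
    by (intro integrable_mult_bounded_continuous assms c)
  obtain B' where "\<And>x. norm (frechet_derivative \<psi> (at x) v) \<le> B'"
    using continuous_compact_support_bounded[OF c(2) K(1) K(3)] by metis
  then show "integrable (lebesgue_on \<Omega>) (\<lambda>x. f x * frechet_derivative \<psi> (at x) v)"
    by (intro integrable_mult_bounded_continuous assms c)
qed

lemma test_function_integrable:
  fixes \<Omega> :: "'a::euclidean_space set"
  assumes "\<psi> \<in> test_functions \<Omega>" "open \<Omega>"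
  shows "integrable (lebesgue_on \<Omega>) \<psi>"
    and "integrable (lebesgue_on \<Omega>) (\<lambda>x. frechet_derivative \<psi> (at x) v)"
proof -
  obtain K where K: "compact K" "K \<subseteq> \<Omega>" "\<And>x. x \<notin> K \<Longrightarrow> \<psi> x = 0" "\<And>x v. x \<notin> K \<Longrightarrow> frechet_derivative \<psi> (at x) v = 0"
    using test_function_support[OF assms(1)] by metis
  note c = test_function_continuous[OF assms(1)] test_function_derivative_continuous[OF assms(1), of v]
  show "integrable (lebesgue_on \<Omega>) \<psi>"
    using K c assms continuous_compact_support_integrable[OF c(1) K(1,3)]
    by (subst lebesgue_on_eq_lborel) (auto intro: borel_measurable_continuous_onI)
  show "integrable (lebesgue_on \<Omega>) (\<lambda>x. frechet_derivative \<psi> (at x) v)"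
    using K c assms continuous_compact_support_integrable[OF c(2) K(1,4)]
    by (subst lebesgue_on_eq_lborel) (auto intro: borel_measurable_continuous_onI)
qed

text \<open>Each entry of the difference of two representatives integrates to zero against every
  test function, so the fundamental lemma applies entrywise. The finitely many null sets are then
  united.\<close>

lemma has_symgrad_unique:
  fixes \<Omega> :: "(real^'n) set"
  assumes "open \<Omega>" and E: "has_symgrad \<Omega> v E" and E': "has_symgrad \<Omega> v E'"
  shows "AE x in lebesgue_on \<Omega>. E x = E' x"
proof -
  have i: "integrable (lebesgue_on \<Omega>) (\<lambda>x. E x $ i $ j)" "integrable (lebesgue_on \<Omega>) (\<lambda>x. E' x $ i $ j)" for i j
    using E E' by (auto simp: has_symgrad_def intro!: integrable_vec_nth)
  have "AE x in lebesgue_on \<Omega>. E x $ i $ j - E' x $ i $ j = 0" for i j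
  proof (rule fundamental_lemma_calculus_of_variations[OF assms(1)])
    show "integrable (lebesgue_on \<Omega>) (\<lambda>x. E x $ i $ j - E' x $ i $ j)" by (intro Bochner_Integration.integrable_diff i)
    fix \<phi> assume \<phi>: "\<phi> \<in> test_functions \<Omega>"
    have "(LINT x|lebesgue_on \<Omega>. F x $ i $ j * \<phi> x) = dist_symgrad \<Omega> v i j \<phi>" if "has_symgrad \<Omega> v F" for F
      using that \<phi> by (simp add: has_symgrad_def)
    from this[OF E] this[OF E'] show "(LINT x|lebesgue_on \<Omega>. (E x $ i $ j - E' x $ i $ j) * \<phi> x) = 0"
      using integrable_mult_test_function(1)[OF i(1) \<phi>, of i j] integrable_mult_test_function(1)[OF i(2) \<phi>, of i j]
      by (simp add: left_diff_distrib)
  qed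
  then have "AE x in lebesgue_on \<Omega>. \<forall>i\<in>UNIV. \<forall>j\<in>UNIV. E x $ i $ j - E' x $ i $ j = 0"
    by (intro AE_finite_allI) auto
  then show ?thesis by eventually_elim (simp add: vec_eq_iff)
qed

section \<open>The symmetric gradient of a difference with a test field\<close>

lemma dist_partial_test_function:
  assumes "open \<Omega>" and \<phi>: "\<phi> \<in> test_functions \<Omega>" and \<psi>: "\<psi> \<in> test_functions \<Omega>"
  shows "dist_partial \<Omega> j \<phi> \<psi> = (LINT x|lebesgue_on \<Omega>. frechet_derivative \<phi> (at x) (axis j 1) * \<psi> x)"
proof -
  obtain K where K: "compact K" "K \<subseteq> \<Omega>" "\<And>x. x \<notin> K \<Longrightarrow> \<psi> x = 0" "\<And>x v. x \<notin> K \<Longrightarrow> frechet_derivative \<psi> (at x) v = 0"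
    using test_function_support[OF \<psi>] by metis
  note c = test_function_continuous[OF \<phi>] test_function_continuous[OF \<psi>]
     test_function_derivative_continuous[OF \<phi>, of "axis j 1"] test_function_derivative_continuous[OF \<psi>, of "axis j 1"]
  have "(LINT x|lebesgue_on \<Omega>. \<phi> x * frechet_derivative \<psi> (at x) (axis j 1)) =
     (LINT x|lborel. \<phi> x * frechet_derivative \<psi> (at x) (axis j 1))"
    using K c \<open>open \<Omega>\<close>
    by (intro lebesgue_on_eq_lborel borel_measurable_continuous_onI) (auto intro!: continuous_intros)
  moreover have "(LINT x|lebesgue_on \<Omega>. frechet_derivative \<phi> (at x) (axis j 1) * \<psi> x) =
     (LINT x|lborel. frechet_derivative \<phi> (at x) (axis j 1) * \<psi> x)"
    using K c \<open>open \<Omega>\<close>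
    by (intro lebesgue_on_eq_lborel borel_measurable_continuous_onI) (auto intro!: continuous_intros)
  ultimately show ?thesis
    unfolding dist_partial_def by (simp add: integration_by_parts_test_functions[OF \<phi> \<psi>])
qed

lemma test_field_component: "\<phi> \<in> test_fields \<Omega> \<Longrightarrow> (\<lambda>x. \<phi> x $ i) \<in> test_functions \<Omega>"
  by (simp add: test_fields_def)

lemma integrable_vec:
  fixes f :: "'a \<Rightarrow> ('b::euclidean_space)^'n"
  assumes "\<And>i. integrable M (\<lambda>x. f x $ i)"
  shows "integrable M f"
proof -
  have "(\<lambda>x. \<Sum>i\<in>UNIV. axis i (f x $ i)) = f"
    by (rule ext) (simp add: vec_eq_iff axis_def if_distrib[where f = "\<lambda>x. x $ _"] sum.delta cong: if_cong)
  moreover have "bounded_linear (axis i :: 'b \<Rightarrow> 'b^'n)" for i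
    by (intro linear_conv_bounded_linear[THEN iffD1] linearI) (auto simp: axis_def vec_eq_iff)
  then have "integrable M (\<lambda>x. \<Sum>i\<in>UNIV. axis i (f x $ i))"
    using assms by (intro Bochner_Integration.integrable_sum integrable_bounded_linear[where T = "axis _"])
  ultimately show ?thesis by simp
qed

lemma classical_symgrad_integrable:
  assumes "open \<Omega>" "\<phi> \<in> test_fields \<Omega>"
  shows "integrable (lebesgue_on \<Omega>) (classical_symgrad \<phi>)"
  using test_function_integrable(2)[OF test_field_component[OF assms(2)] assms(1)]
  by (intro integrable_vec) (simp add: classical_symgrad_def)

lemma test_field_integrable:
  assumes "open \<Omega>" "\<phi> \<in> test_fields \<Omega>"
  shows "integrable (lebesgue_on \<Omega>) \<phi>"
  using test_function_integrable(1)[OF test_field_component[OF assms(2)] assms(1)]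
  by (rule integrable_vec)

text \<open>Differences u - \<phi> are what the approximation in \<open>X11\<close> measures. The
  distributional derivatives of \<phi> are its classical ones by integration by parts, and the rest
  is linearity of the integral.\<close>

lemma has_symgrad_diff_test_field:
  fixes \<Omega> :: "(real^'n) set"
  assumes "open \<Omega>" and u: "integrable (lebesgue_on \<Omega>) u" and E: "has_symgrad \<Omega> u E"
    and \<phi>: "\<phi> \<in> test_fields \<Omega>"
  shows "has_symgrad \<Omega> (\<lambda>x. u x - \<phi> x) (\<lambda>x. E x - classical_symgrad \<phi> x)"
  unfolding has_symgrad_def
proof (intro conjI ballI allI)
  have Ei: "integrable (lebesgue_on \<Omega>) E" using E by (simp add: has_symgrad_def)
  then show "integrable (lebesgue_on \<Omega>) (\<lambda>x. E x - classical_symgrad \<phi> x)"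
    using classical_symgrad_integrable[OF assms(1) \<phi>] by simp
  fix \<psi> i j assume \<psi>: "\<psi> \<in> test_functions \<Omega>"
  note c = test_field_component[OF \<phi>]
  have "dist_partial \<Omega> j (\<lambda>x. (u x - \<phi> x) $ i) \<psi> = dist_partial \<Omega> j (\<lambda>x. u x $ i) \<psi> -
      (LINT x|lebesgue_on \<Omega>. frechet_derivative (\<lambda>x. \<phi> x $ i) (at x) (axis j 1) * \<psi> x)" for i j
    using integrable_mult_test_function(2)[OF integrable_vec_nth[OF u] \<psi>, of i "axis j 1"]
      integrable_mult_test_function(2)[OF test_function_integrable(1)[OF c assms(1)] \<psi>, of i "axis j 1"]
    unfolding dist_partial_test_function[OF assms(1) c \<psi>, symmetric]
    by (simp add: dist_partial_def left_diff_distrib)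
  then have "dist_symgrad \<Omega> (\<lambda>x. u x - \<phi> x) i j \<psi> = dist_symgrad \<Omega> u i j \<psi> -
      ((LINT x|lebesgue_on \<Omega>. frechet_derivative (\<lambda>x. \<phi> x $ i) (at x) (axis j 1) * \<psi> x) +
       (LINT x|lebesgue_on \<Omega>. frechet_derivative (\<lambda>x. \<phi> x $ j) (at x) (axis i 1) * \<psi> x)) / 2"
    unfolding dist_symgrad_def by (simp only: diff_divide_distrib add_divide_distrib)
  also have "dist_symgrad \<Omega> u i j \<psi> = (LINT x|lebesgue_on \<Omega>. E x $ i $ j * \<psi> x)"
    using E \<psi> by (simp add: has_symgrad_def)
  also have "(LINT x|lebesgue_on \<Omega>. E x $ i $ j * \<psi> x) -
      ((LINT x|lebesgue_on \<Omega>. frechet_derivative (\<lambda>x. \<phi> x $ i) (at x) (axis j 1) * \<psi> x) +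
       (LINT x|lebesgue_on \<Omega>. frechet_derivative (\<lambda>x. \<phi> x $ j) (at x) (axis i 1) * \<psi> x)) / 2 =
     (LINT x|lebesgue_on \<Omega>. E x $ i $ j * \<psi> x - (frechet_derivative (\<lambda>x. \<phi> x $ i) (at x) (axis j 1) * \<psi> x +
        frechet_derivative (\<lambda>x. \<phi> x $ j) (at x) (axis i 1) * \<psi> x) / 2)"
    using integrable_mult_test_function(1)[OF integrable_vec_nth[OF integrable_vec_nth[OF Ei]] \<psi>]
      integrable_mult_test_function(1)[OF test_function_integrable(2)[OF c assms(1)] \<psi>]
    by simp
  also have "\<dots> = (LINT x|lebesgue_on \<Omega>. (E x - classical_symgrad \<phi> x) $ i $ j * \<psi> x)"
    by (simp add: classical_symgrad_def field_simps)
  finally show "dist_symgrad \<Omega> (\<lambda>x. u x - \<phi> x) i j \<psi> =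
    (LINT x|lebesgue_on \<Omega>. (E x - classical_symgrad \<phi> x) $ i $ j * \<psi> x)" .
qed

lemma E11_symgrad: "u \<in> E11 \<Omega> \<Longrightarrow> has_symgrad \<Omega> u (symgrad \<Omega> u)"
  unfolding E11_def symgrad_def by (auto intro: someI[of "has_symgrad \<Omega> u"])

lemma E11_diff_test_field:
  assumes "open \<Omega>" "u \<in> E11 \<Omega>" "\<phi> \<in> test_fields \<Omega>"
  shows "(\<lambda>x. u x - \<phi> x) \<in> E11 \<Omega>"
proof -
  have "integrable (lebesgue_on \<Omega>) u" using assms(2) by (simp add: E11_def)
  then show ?thesis
    using has_symgrad_diff_test_field[OF assms(1) _ E11_symgrad[OF assms(2)] assms(3)]
      test_field_integrable[OF assms(1,3)]
    unfolding E11_def by blast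
qed

text \<open>The choice in \<open>symgrad\<close> is made for each field separately, so it is not
  linear by construction. Uniqueness of representatives yields the identity almost
  everywhere.\<close>

lemma symgrad_diff_test_field:
  assumes "open \<Omega>" "u \<in> E11 \<Omega>" "\<phi> \<in> test_fields \<Omega>"
  shows "AE x in lebesgue_on \<Omega>. symgrad \<Omega> (\<lambda>x. u x - \<phi> x) x = symgrad \<Omega> u x - classical_symgrad \<phi> x"
proof (rule has_symgrad_unique[OF assms(1) E11_symgrad[OF E11_diff_test_field[OF assms]]])
  show "has_symgrad \<Omega> (\<lambda>x. u x - \<phi> x) (\<lambda>x. symgrad \<Omega> u x - classical_symgrad \<phi> x)"
    using assms(2) by (intro has_symgrad_diff_test_field assms E11_symgrad) (simp add: E11_def)
qed

section \<open>Exterior balls at a Lipschitz boundary\<close>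

text \<open>The centre lies at depth r/2 below the boundary point q, in direction -e. The graph of g
  has slope at most L, so a ball of radius proportional to r around it stays on or below the graph.
  The same \<kappa> and \<rho> serve all boundary points q near p.\<close>

lemma lipschitz_boundary_local_exterior_ball:
  fixes \<Omega> :: "'a::euclidean_space set"
  assumes "open \<Omega>" "lipschitz_boundary \<Omega>" "p \<in> frontier \<Omega>"
  shows "\<exists>\<kappa>>0. \<exists>\<rho>>0. \<forall>q \<in> frontier \<Omega> \<inter> ball p \<rho>. \<forall>r. 0 < r \<and> r \<le> \<rho> \<longrightarrow>
           (\<exists>z. ball z (\<kappa> * r) \<subseteq> ball q r - \<Omega>)"
proof -
  obtain \<rho> e g L where \<rho>: "\<rho> > 0" and e: "norm e = 1" and g: "L-lipschitz_on {y. y \<bullet> e = 0} g"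
    and eq: "\<Omega> \<inter> ball p \<rho> = {x \<in> ball p \<rho>. g (x - (x \<bullet> e) *\<^sub>R e) < x \<bullet> e}"
    using assms(2)[unfolded lipschitz_boundary_def, rule_format, OF assms(3)] by blast
  have L: "0 \<le> L" using g by (rule lipschitz_on_nonneg)
  have ee: "e \<bullet> e = 1" using e by (simp add: dot_square_norm)
  define P where "P x = x - (x \<bullet> e) *\<^sub>R e" for x
  have P: "P x \<bullet> e = 0" for x by (simp add: P_def inner_diff_left ee)
  have P_norm: "norm (P x) \<le> norm x" for x
  proof -
    have "(norm (P x))\<^sup>2 = (norm x)\<^sup>2 - (x \<bullet> e)\<^sup>2"
      unfolding power2_norm_eq_inner P_def
      by (simp add: inner_diff_left inner_diff_right ee inner_commute[of e x] power2_eq_square)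
    then have "(norm (P x))\<^sup>2 \<le> (norm x)\<^sup>2" by simp
    then show ?thesis by (rule power2_le_imp_le) simp
  qed
  \<comment> \<open>Chosen so that \<kappa> + L \<kappa> = 1/2: within the ball the height rises by
    less than \<kappa> r and g falls by at most L \<kappa> r, together at most the depth r/2.
    Moreover \<kappa> \<le> 1/2 keeps the ball inside \<open>ball q r\<close>.\<close>
  define \<kappa> where "\<kappa> = 1 / (2 * (1 + L))"
  have \<kappa>: "0 < \<kappa>" "\<kappa> \<le> 1 / 2" "\<kappa> + L * \<kappa> = 1 / 2"
    using L by (auto simp: \<kappa>_def field_simps)
  \<comment> \<open>Halving \<rho> both for q and for r keeps \<open>ball q r\<close> within
    \<open>ball p \<rho>\<close>, where the graph description is valid.\<close>
  have "\<exists>z. ball z (\<kappa> * r) \<subseteq> ball q r - \<Omega>"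
    if q: "q \<in> frontier \<Omega>" "q \<in> ball p (\<rho> / 2)" and r: "0 < r" "r \<le> \<rho> / 2" for q r
  proof (intro exI[of _ "q - (r / 2) *\<^sub>R e"] subsetI)
    \<comment> \<open>An open set contains none of its boundary points, so q lies on or below the
      graph of g.\<close>
    have "q \<notin> \<Omega>" using q(1) assms(1) by (simp add: frontier_def interior_open)
    moreover have "q \<in> ball p \<rho>" using q(2) \<rho> by auto
    ultimately have gq: "q \<bullet> e \<le> g (P q)" using eq unfolding P_def by force
    fix z assume "z \<in> ball (q - (r / 2) *\<^sub>R e) (\<kappa> * r)"
    define y where "y = z - (q - (r / 2) *\<^sub>R e)"
    have y: "norm y < \<kappa> * r" and z: "z = q - (r / 2) *\<^sub>R e + y"
      using \<open>z \<in> _\<close> by (auto simp: y_def dist_norm norm_minus_commute)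
    have "norm (y - (r / 2) *\<^sub>R e) \<le> norm y + norm ((r / 2) *\<^sub>R e)" by (rule norm_triangle_ineq4)
    also have "norm ((r / 2) *\<^sub>R e) = r / 2" using e r by simp
    also have "\<kappa> * r \<le> 1 / 2 * r" using \<kappa>(2) r by (intro mult_right_mono) auto
    then have "norm y + r / 2 < r" using y by simp
    finally have dzq: "dist q z < r" by (simp add: z dist_norm norm_minus_commute algebra_simps)
    have zp: "z \<in> ball p \<rho>"
      using dzq q(2) r dist_triangle[of p z q] by simp
    have "P z - P q = P y"
      by (simp add: P_def z inner_add_left inner_diff_left ee algebra_simps)
    then have "dist (P z) (P q) \<le> norm y" using P_norm[of y] by (simp add: dist_norm)
    then have "\<bar>g (P z) - g (P q)\<bar> \<le> L * norm y"
      using lipschitz_onD[OF g, of "P z" "P q"] P L mult_left_mono[of "dist (P z) (P q)" "norm y" L]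
      by (simp add: dist_real_def)
    moreover have "L * norm y \<le> L * (\<kappa> * r)" using y L by (intro mult_left_mono) auto
    moreover have "z \<bullet> e \<le> q \<bullet> e - r / 2 + norm y"
      using norm_cauchy_schwarz[of y e] e by (simp add: z inner_add_left inner_diff_left ee)
    moreover have "\<kappa> * r + L * (\<kappa> * r) = r / 2"
      using arg_cong[OF \<kappa>(3), of "\<lambda>c. c * r"] by (simp add: distrib_right mult.assoc)
    ultimately have "\<not> g (P z) < z \<bullet> e" using gq y by linarith
    then have "z \<notin> \<Omega>" using eq zp unfolding P_def by blast
    with dzq show "z \<in> ball q r - \<Omega>" by simp
  qed
  with \<kappa>(1) \<rho> show ?thesis
    by (intro exI[of _ \<kappa>] conjI exI[of _ "\<rho> / 2"]) auto
qed

text \<open>Compactness of the boundary makes the local constants uniform. The ball found near the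
  boundary point nearest to x, at distance r, serves x as well, because \<open>ball q r\<close> lies
  in \<open>ball x (2 * r)\<close>; this is the origin of the factor 2.\<close>

lemma bounded_lipschitz_domain_exterior_ball:
  fixes \<Omega> :: "'a::euclidean_space set"
  assumes "bounded_lipschitz_domain \<Omega>"
  shows "\<exists>\<kappa>>0. \<exists>h>0. \<forall>x\<in>\<Omega>. infdist x (frontier \<Omega>) \<le> h \<longrightarrow> 0 < infdist x (frontier \<Omega>) \<and>
     (\<exists>z. ball z (\<kappa> * infdist x (frontier \<Omega>)) \<subseteq> ball x (2 * infdist x (frontier \<Omega>)) - \<Omega>)"
proof -
  have \<Omega>: "open \<Omega>" "bounded \<Omega>" "\<Omega> \<noteq> {}" "lipschitz_boundary \<Omega>"
    using assms by (auto simp: bounded_lipschitz_domain_def)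
  \<comment> \<open>An empty frontier would make \<open>\<Omega>\<close> empty or the whole space.
    Nonemptiness matters because \<open>infdist\<close> to the empty set is 0 by convention.\<close>
  have ne: "frontier \<Omega> \<noteq> {}"
    using \<Omega> by (simp add: frontier_eq_empty) (metis not_bounded_UNIV)
  have comp: "compact (frontier \<Omega>)" using \<Omega>(2) by (rule compact_frontier_bounded)
  obtain \<kappa> \<rho> where k: "\<And>p. p \<in> frontier \<Omega> \<Longrightarrow> \<kappa> p > 0 \<and> \<rho> p > 0 \<and>
      (\<forall>q \<in> frontier \<Omega> \<inter> ball p (\<rho> p). \<forall>r. 0 < r \<and> r \<le> \<rho> p \<longrightarrow> (\<exists>z. ball z (\<kappa> p * r) \<subseteq> ball q r - \<Omega>))"
    using lipschitz_boundary_local_exterior_ball[OF \<Omega>(1,4)] by metis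
  obtain C where C: "C \<subseteq> frontier \<Omega>" "finite C" "frontier \<Omega> \<subseteq> (\<Union>p\<in>C. ball p (\<rho> p))"
    by (rule compactE_image[OF comp, of "frontier \<Omega>" "\<lambda>p. ball p (\<rho> p)"]) (use k in force)+
  have Cne: "C \<noteq> {}" using C(3) ne by auto
  \<comment> \<open>Minima over the centres of a finite subcover remain positive.\<close>
  define \<kappa>0 h0 where "\<kappa>0 = Min (\<kappa> ` C)" and "h0 = Min (\<rho> ` C)"
  have "\<kappa>0 > 0" "h0 > 0" using C Cne k by (auto simp: \<kappa>0_def h0_def subset_iff)
  moreover have "0 < infdist x (frontier \<Omega>) \<and>
     (\<exists>z. ball z (\<kappa>0 * infdist x (frontier \<Omega>)) \<subseteq> ball x (2 * infdist x (frontier \<Omega>)) - \<Omega>)"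
    if x: "x \<in> \<Omega>" "infdist x (frontier \<Omega>) \<le> h0" for x
  proof -
    define r where "r = infdist x (frontier \<Omega>)"
    obtain q where q: "q \<in> frontier \<Omega>" "r = dist x q"
      using infdist_attains_inf[OF frontier_closed ne] unfolding r_def by metis
    have "q \<notin> \<Omega>" using q(1) \<Omega>(1) by (simp add: frontier_def interior_open)
    then have r: "r > 0" using q x by auto
    obtain p where p: "p \<in> C" "q \<in> ball p (\<rho> p)" using C(3) q(1) by blast
    have "h0 \<le> \<rho> p" using p(1) C(2) by (simp add: h0_def)
    then have "r \<le> \<rho> p" using x(2) by (simp add: r_def)
    then obtain z where z: "ball z (\<kappa> p * r) \<subseteq> ball q r - \<Omega>"
      using k[of p] p q(1) C(1) r by blast
    have "\<kappa>0 * r \<le> \<kappa> p * r" using p(1) C(2) r by (intro mult_right_mono) (auto simp: \<kappa>0_def)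
    then have "ball z (\<kappa>0 * r) \<subseteq> ball z (\<kappa> p * r)" by (rule subset_ball)
    moreover have "ball q r \<subseteq> ball x (2 * r)"
      using q(2) by (simp add: ball_subset_ball_iff dist_commute)
    ultimately show ?thesis using z r unfolding r_def by blast
  qed
  ultimately show ?thesis by blast
qed

section \<open>The estimate for test fields\<close>

text \<open>The matrix is the outer product w w^T. Its Frobenius norm is the Cauchy-Schwarz factor
  in the estimate along a segment.\<close>

lemma norm_outer_square:
  fixes w :: "real^'n"
  shows "norm ((\<chi> i. w $ i *\<^sub>R w) :: real^'n^'n) = (norm w)\<^sup>2"
proof -
  have "norm ((\<chi> i. w $ i *\<^sub>R w) :: real^'n^'n) = L2_set (\<lambda>i. norm w * norm (w $ i)) UNIV"
    by (simp add: norm_vec_def[of "\<chi> i. w $ i *\<^sub>R w"] mult.commute)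
  also have "\<dots> = norm w * norm w"
    by (subst L2_set_right_distrib[symmetric]) (simp_all add: norm_vec_def[of w])
  finally show ?thesis by (simp add: power2_eq_square)
qed

lemma classical_symgrad_continuous:
  assumes "\<phi> \<in> test_fields \<Omega>"
  shows "continuous_on UNIV (classical_symgrad \<phi>)"
  unfolding classical_symgrad_def
  by (intro continuous_intros test_function_derivative_continuous[OF test_field_component[OF assms]]) auto

lemma classical_symgrad_eq_0:
  assumes "\<phi> \<in> test_fields \<Omega>" "y \<notin> \<Omega>"
  shows "classical_symgrad \<phi> y = 0"
proof -
  have "frechet_derivative (\<lambda>x. \<phi> x $ i) (at y) v = 0" for i v
    using test_function_support[OF test_field_component[OF assms(1), of i]] assms(2) by (metis subsetD)
  then show ?thesis by (simp add: classical_symgrad_def vec_eq_iff)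
qed

text \<open>Along a segment only the symmetric part of the gradient enters the derivative of the
  component of the field in the direction of the segment.\<close>

lemma test_field_segment_derivative:
  fixes \<phi> :: "real^'n \<Rightarrow> real^'n"
  assumes "\<phi> \<in> test_fields \<Omega>"
  shows "((\<lambda>t. \<phi> (x + t *\<^sub>R w) \<bullet> w) has_real_derivative
     classical_symgrad \<phi> (x + t *\<^sub>R w) \<bullet> (\<chi> i. w $ i *\<^sub>R w)) (at t)"
proof -
  let ?D = "\<lambda>i. frechet_derivative (\<lambda>x. \<phi> x $ i) (at (x + t *\<^sub>R w))"
  have der: "((\<lambda>x. \<phi> x $ i) has_derivative ?D i) (at (x + t *\<^sub>R w))" for i
    by (rule test_function_has_derivative[OF test_field_component[OF assms]])
  have lin: "linear (?D i)" for i by (rule has_derivative_linear[OF der])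
  have "((\<lambda>t. \<phi> (x + t *\<^sub>R w) $ i) has_real_derivative ?D i w) (at t)" for i
  proof -
    have "((\<lambda>t. \<phi> (x + t *\<^sub>R w) $ i) has_derivative (\<lambda>s. ?D i (s *\<^sub>R w))) (at t)"
      by (rule has_derivative_compose[where f = "\<lambda>t. x + t *\<^sub>R w" and g = "\<lambda>x. \<phi> x $ i"])
         (auto intro!: derivative_eq_intros der)
    then show ?thesis
      by (simp add: has_field_derivative_def linear_cmul[OF lin] mult.commute[of _ "?D i w"])
  qed
  then have "((\<lambda>t. \<Sum>i\<in>UNIV. \<phi> (x + t *\<^sub>R w) $ i * w $ i) has_real_derivative (\<Sum>i\<in>UNIV. ?D i w * w $ i)) (at t)"
    by (intro DERIV_sum DERIV_cmult_right)
  moreover have "(\<Sum>i\<in>UNIV. ?D i w * w $ i) = classical_symgrad \<phi> (x + t *\<^sub>R w) \<bullet> (\<chi> i. w $ i *\<^sub>R w)"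
  proof -
    have "?D i w = (\<Sum>j\<in>UNIV. w $ j * ?D i (axis j 1))" for i
    proof -
      have "?D i w = ?D i (\<Sum>j\<in>UNIV. w $ j *\<^sub>R axis j 1)"
        by (simp add: basis_expansion scalar_mult_eq_scaleR[symmetric])
      also have "\<dots> = (\<Sum>j\<in>UNIV. w $ j * ?D i (axis j 1))"
        by (simp add: linear_sum[OF lin] linear_cmul[OF lin])
      finally show ?thesis .
    qed
    then have eq: "(\<Sum>i\<in>UNIV. ?D i w * w $ i) = (\<Sum>i\<in>UNIV. \<Sum>j\<in>UNIV. w $ i * (w $ j * ?D i (axis j 1)))"
      by (simp add: sum_distrib_left mult.commute)
    \<comment> \<open>Exchanging the two summation indices replaces the gradient by its transpose in
      the quadratic form. Averaging \<open>eq\<close> and \<open>eq'\<close> gives the symmetric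
      part.\<close>
    have eq': "(\<Sum>i\<in>UNIV. ?D i w * w $ i) = (\<Sum>i\<in>UNIV. \<Sum>j\<in>UNIV. w $ i * (w $ j * ?D j (axis i 1)))"
      unfolding eq by (subst sum.swap) (simp add: mult.left_commute)
    have "classical_symgrad \<phi> (x + t *\<^sub>R w) \<bullet> (\<chi> i. w $ i *\<^sub>R w) =
      (\<Sum>i\<in>UNIV. \<Sum>j\<in>UNIV. w $ i * (w $ j * ?D i (axis j 1)) / 2 + w $ i * (w $ j * ?D j (axis i 1)) / 2)"
      by (simp add: inner_vec_def classical_symgrad_def sum_distrib_left algebra_simps add_divide_distrib)
    also have "\<dots> = (\<Sum>i\<in>UNIV. ?D i w * w $ i) / 2 + (\<Sum>i\<in>UNIV. ?D i w * w $ i) / 2"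
      by (subst eq, subst eq') (simp add: sum.distrib sum_divide_distrib)
    finally show ?thesis by simp
  qed
  ultimately show ?thesis by (simp add: inner_vec_def[of "\<phi> _"])
qed

text \<open>The fundamental theorem of calculus on [0, 1], combined with Cauchy-Schwarz for
  matrices. The segment may leave \<open>\<Omega>\<close> before its endpoint, which does no harm
  since \<phi> is smooth on the whole space.\<close>

lemma test_field_segment_bound:
  fixes \<phi> :: "real^'n \<Rightarrow> real^'n"
  assumes \<phi>: "\<phi> \<in> test_fields \<Omega>" and "x + w \<notin> \<Omega>"
  shows "ennreal \<bar>\<phi> x \<bullet> w\<bar> \<le>
    ennreal ((norm w)\<^sup>2) * (\<integral>\<^sup>+t. ennreal (norm (classical_symgrad \<phi> (x + t *\<^sub>R w))) * indicator {0..1} t \<partial>lborel)"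
proof -
  let ?h = "\<lambda>t. classical_symgrad \<phi> (x + t *\<^sub>R w) \<bullet> (\<chi> i. w $ i *\<^sub>R w)"
  note cont = continuous_on_compose2[OF classical_symgrad_continuous[OF \<phi>], of UNIV "\<lambda>t. x + t *\<^sub>R w"]
  have hc: "continuous_on UNIV ?h"
    by (intro continuous_intros cont) auto
  have [measurable]: "(\<lambda>t. norm (classical_symgrad \<phi> (x + t *\<^sub>R w))) \<in> borel_measurable borel"
    by (intro borel_measurable_continuous_onI continuous_intros cont) auto
  have "\<phi> (x + w) = 0"
    using test_function_support[OF test_field_component[OF \<phi>]] assms(2)
    by (subst vec_eq_iff) (metis subsetD zero_index)
  moreover have "has_bochner_integral lborel (\<lambda>t. ?h t * indicator {0..1} t) (\<phi> (x + 1 *\<^sub>R w) \<bullet> w - \<phi> (x + 0 *\<^sub>R w) \<bullet> w)"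
    using hc by (intro has_bochner_integral_FTC_Icc_real test_field_segment_derivative[OF \<phi>])
       (auto simp: continuous_on_eq_continuous_at)
  ultimately have "has_bochner_integral lborel (\<lambda>t. ?h t * indicator {0..1} t) (- (\<phi> x \<bullet> w))" by simp
  then have "ennreal (norm (- (\<phi> x \<bullet> w))) \<le> (\<integral>\<^sup>+t. norm (?h t * indicator {0..1} t) \<partial>lborel)"
    by (rule has_bochner_integral_norm_bound)
  also have "\<dots> \<le> (\<integral>\<^sup>+t. ennreal ((norm w)\<^sup>2) * (ennreal (norm (classical_symgrad \<phi> (x + t *\<^sub>R w))) * indicator {0..1} t) \<partial>lborel)"
  proof (rule nn_integral_mono)
    fix t :: real
    have "\<bar>?h t\<bar> \<le> (norm w)\<^sup>2 * norm (classical_symgrad \<phi> (x + t *\<^sub>R w))"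
      using Cauchy_Schwarz_ineq2[of "classical_symgrad \<phi> (x + t *\<^sub>R w)" "\<chi> i. w $ i *\<^sub>R w"]
      by (simp add: norm_outer_square mult.commute)
    then show "ennreal (norm (?h t * indicator {0..1} t)) \<le>
        ennreal ((norm w)\<^sup>2) * (ennreal (norm (classical_symgrad \<phi> (x + t *\<^sub>R w))) * indicator {0..1} t)"
      by (auto simp: indicator_def ennreal_mult[symmetric] intro!: ennreal_leI)
  qed
  also have "\<dots> = ennreal ((norm w)\<^sup>2) * (\<integral>\<^sup>+t. ennreal (norm (classical_symgrad \<phi> (x + t *\<^sub>R w))) * indicator {0..1} t \<partial>lborel)"
    by (rule nn_integral_cmult) measurable
  finally show ?thesis by simp
qed

section \<open>Averaging the segment integrals over displacements\<close>

lemma nn_integral_lborel_scale: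
  fixes x :: "'a::euclidean_space" and H :: "'a \<Rightarrow> ennreal"
  assumes [measurable]: "H \<in> borel_measurable borel" and t: "t > 0"
  shows "(\<integral>\<^sup>+w. H (x + t *\<^sub>R w) \<partial>lborel) = ennreal (inverse (t ^ DIM('a))) * (\<integral>\<^sup>+y. H y \<partial>lborel)"
proof -
  have "(\<integral>\<^sup>+y. H y \<partial>lborel) = ennreal (t ^ DIM('a)) * (\<integral>\<^sup>+w. H (x + t *\<^sub>R w) \<partial>lborel)"
    using t by (subst lborel_affine[of t x]) (auto simp: nn_integral_density nn_integral_distr nn_integral_cmult)
  then show ?thesis
    using t by (simp add: mult.assoc[symmetric] ennreal_mult[symmetric])
qed

lemma nn_integral_inverse_power_atLeast:
  fixes a :: real
  assumes a: "a > 0"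
  shows "(\<integral>\<^sup>+t. ennreal (inverse (t ^ Suc (Suc m))) * indicator {a..} t \<partial>lborel) = ennreal (inverse (Suc m * a ^ Suc m))"
proof -
  have "(\<integral>\<^sup>+t. ennreal (inverse (t ^ Suc (Suc m))) * indicator {a..} t \<partial>lborel) =
      ennreal (0 - - inverse (Suc m * a ^ Suc m))"
  proof (rule nn_integral_FTC_atLeast)
    show "((\<lambda>t. - inverse (Suc m * t ^ Suc m)) has_real_derivative inverse (t ^ Suc (Suc m))) (at t)" if "a \<le> t" for t
    proof -
      have t: "t > 0" using a that by simp
      have "((\<lambda>t. t ^ Suc m) has_real_derivative Suc m * t ^ m) (at t)"
        using DERIV_pow[of "Suc m" t] by simp
      then have "((\<lambda>t. - (inverse (Suc m) * inverse (t ^ Suc m))) has_real_derivative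
          - (inverse (Suc m) * - (inverse (t ^ Suc m) * (Suc m * t ^ m) * inverse (t ^ Suc m)))) (at t)"
        using t by (intro DERIV_minus DERIV_cmult DERIV_inverse') auto
      moreover have "- (inverse (Suc m) * - (inverse (t ^ Suc m) * (Suc m * t ^ m) * inverse (t ^ Suc m))) =
          inverse (t ^ Suc (Suc m))"
        using t by (simp add: divide_simps)
      ultimately show ?thesis by (simp only: inverse_mult_distrib)
    qed
    have "((\<lambda>t::real. - (inverse (Suc m) * inverse (t ^ Suc m))) \<longlongrightarrow> - (inverse (Suc m) * 0)) at_top"
      by (intro tendsto_intros tendsto_inverse_0_at_top filterlim_pow_at_top filterlim_ident) auto
    then show "((\<lambda>t::real. - inverse (Suc m * t ^ Suc m)) \<longlongrightarrow> 0) at_top" by simp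
  qed (use a in auto)
  then show ?thesis by simp
qed

text \<open>For fixed t substitute y = x + t w, then integrate in t first. Only t \<ge> \<bar>x -
  y\<bar> / R contribute, and integrating t^(-d) over them, with d = m + 2, yields the kernel
  \<bar>x - y\<bar>^(1-d) with the factor R^(d-1) / (d-1).\<close>

lemma nn_integral_segments_le_riesz_potential:
  fixes f :: "'a::euclidean_space \<Rightarrow> ennreal"
  assumes [measurable]: "f \<in> borel_measurable borel" and d: "DIM('a) = Suc (Suc m)" and R: "R > 0"
  shows "(\<integral>\<^sup>+w. (\<integral>\<^sup>+t. f (x + t *\<^sub>R w) * indicator {0..1} t \<partial>lborel) * indicator (ball 0 R) w \<partial>lborel) \<le>
    ennreal (R ^ Suc m / Suc m) * (\<integral>\<^sup>+y. f y * ennreal (1 / norm (x - y) ^ Suc m) * indicator (ball x R) y \<partial>lborel)"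
proof -
  have [measurable]: "ball c \<rho> \<in> sets borel" for c :: 'a and \<rho> by simp
  \<comment> \<open>The weight after the substitution: the Jacobian t^(-d), together with the
    condition \<bar>w\<bar> < R rewritten as \<bar>x - y\<bar> < t R.\<close>
  define k :: "real \<Rightarrow> 'a \<Rightarrow> ennreal" where
    "k t y = ennreal (inverse (t ^ DIM('a))) * (if 0 < t \<and> t \<le> 1 \<and> dist x y < t * R then 1 else 0)" for t y
  have [measurable]: "(\<lambda>p. k (fst p) (snd p)) \<in> borel_measurable (borel \<Otimes>\<^sub>M borel)"
    "(\<lambda>p. k (snd p) (fst p)) \<in> borel_measurable (borel \<Otimes>\<^sub>M borel)"
    "(\<lambda>t. k t y) \<in> borel_measurable borel" "(\<lambda>y. k t y) \<in> borel_measurable borel" for t y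
    unfolding k_def by measurable
  have "(\<integral>\<^sup>+w. (\<integral>\<^sup>+t. f (x + t *\<^sub>R w) * indicator {0..1} t \<partial>lborel) * indicator (ball 0 R) w \<partial>lborel) =
      (\<integral>\<^sup>+w. (\<integral>\<^sup>+t. f (x + t *\<^sub>R w) * indicator {0..1} t * indicator (ball 0 R) w \<partial>lborel) \<partial>lborel)"
    by (simp add: nn_integral_multc)
  also have "\<dots> = (\<integral>\<^sup>+t. (\<integral>\<^sup>+w. f (x + t *\<^sub>R w) * indicator {0..1} t * indicator (ball 0 R) w \<partial>lborel) \<partial>lborel)"
    by (rule lborel_pair.Fubini'[symmetric]) measurable
  also have "\<dots> = (\<integral>\<^sup>+t. (\<integral>\<^sup>+y. f y * k t y \<partial>lborel) \<partial>lborel)"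
  proof (rule nn_integral_cong_AE, use AE_lborel_singleton[of 0] in eventually_elim)
    \<comment> \<open>The substitution degenerates at t = 0, which is a null set.\<close>
    fix t :: real assume "t \<noteq> 0"
    show "(\<integral>\<^sup>+w. f (x + t *\<^sub>R w) * indicator {0..1} t * indicator (ball 0 R) w \<partial>lborel) = (\<integral>\<^sup>+y. f y * k t y \<partial>lborel)"
    proof (cases "0 < t \<and> t \<le> 1")
      case True
      then have t: "0 < t" "t \<le> 1" by auto
      have "(\<integral>\<^sup>+w. f (x + t *\<^sub>R w) * indicator {0..1} t * indicator (ball 0 R) w \<partial>lborel) =
          (\<integral>\<^sup>+w. (\<lambda>y. f y * (if dist x y < t * R then 1 else 0)) (x + t *\<^sub>R w) \<partial>lborel)"
        using t by (intro nn_integral_cong) (auto simp: indicator_def dist_norm)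
      also have "\<dots> = ennreal (inverse (t ^ DIM('a))) * (\<integral>\<^sup>+y. f y * (if dist x y < t * R then 1 else 0) \<partial>lborel)"
        by (rule nn_integral_lborel_scale) (use t in measurable)
      also have "\<dots> = (\<integral>\<^sup>+y. f y * k t y \<partial>lborel)"
        using t by (subst nn_integral_cmult[symmetric]) (auto simp: k_def mult_ac intro!: nn_integral_cong)
      finally show ?thesis .
    qed (use \<open>t \<noteq> 0\<close> in \<open>auto simp: k_def indicator_def\<close>)
  qed
  also have "\<dots> = (\<integral>\<^sup>+y. (\<integral>\<^sup>+t. f y * k t y \<partial>lborel) \<partial>lborel)"
    by (rule lborel_pair.Fubini'[symmetric]) (simp add: split_beta')
  also have "\<dots> = (\<integral>\<^sup>+y. f y * (\<integral>\<^sup>+t. k t y \<partial>lborel) \<partial>lborel)"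
    by (intro nn_integral_cong nn_integral_cmult) measurable
  also have "\<dots> \<le> (\<integral>\<^sup>+y. ennreal (R ^ Suc m / Suc m) * (f y * ennreal (1 / norm (x - y) ^ Suc m) * indicator (ball x R) y) \<partial>lborel)"
  proof (rule nn_integral_mono_AE, use AE_lborel_singleton[of x] in eventually_elim)
    \<comment> \<open>At y = x division by zero gives the kernel the value 0, while the integral
      over t diverges. This single point is discarded.\<close>
    fix y :: 'a assume "y \<noteq> x"
    then have pos: "norm (x - y) > 0" by simp
    have "(\<integral>\<^sup>+t. k t y \<partial>lborel) \<le> (\<integral>\<^sup>+t. ennreal (inverse (t ^ Suc (Suc m))) * indicator {norm (x - y) / R..} t * indicator (ball x R) y \<partial>lborel)"
    proof (rule nn_integral_mono)
      fix t :: real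
      have "norm (x - y) / R \<le> t" "dist x y < R" if "0 < t" "t \<le> 1" "dist x y < t * R"
      proof -
        show "norm (x - y) / R \<le> t" using that R by (simp add: dist_norm field_simps)
        have "t * R \<le> 1 * R" using that R by (intro mult_right_mono) auto
        with that(3) show "dist x y < R" by simp
      qed
      then show "k t y \<le> ennreal (inverse (t ^ Suc (Suc m))) * indicator {norm (x - y) / R..} t * indicator (ball x R) y"
        by (auto simp: k_def d simp del: power_Suc)
    qed
    also have "\<dots> = ennreal (inverse (Suc m * (norm (x - y) / R) ^ Suc m)) * indicator (ball x R) y"
      using pos R by (subst nn_integral_multc) (simp_all add: nn_integral_inverse_power_atLeast del: power_Suc of_nat_Suc)
    also have "ennreal (inverse (Suc m * (norm (x - y) / R) ^ Suc m)) = ennreal (R ^ Suc m / Suc m) * ennreal (1 / norm (x - y) ^ Suc m)"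
      using pos R by (subst ennreal_mult[symmetric]) (auto simp: power_divide divide_simps simp del: power_Suc of_nat_Suc)
    finally have "f y * (\<integral>\<^sup>+t. k t y \<partial>lborel) \<le> f y * (ennreal (R ^ Suc m / Suc m) * ennreal (1 / norm (x - y) ^ Suc m) * indicator (ball x R) y)"
      by (rule mult_left_mono) simp
    then show "f y * (\<integral>\<^sup>+t. k t y \<partial>lborel) \<le> ennreal (R ^ Suc m / Suc m) * (f y * ennreal (1 / norm (x - y) ^ Suc m) * indicator (ball x R) y)"
      by (simp add: mult_ac)
  qed
  also have "\<dots> = ennreal (R ^ Suc m / Suc m) * (\<integral>\<^sup>+y. f y * ennreal (1 / norm (x - y) ^ Suc m) * indicator (ball x R) y \<partial>lborel)"
    by (rule nn_integral_cmult) measurable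
  finally show ?thesis .
qed

text \<open>The integrand is small only near the hyperplane orthogonal to a. Every ball of radius s
  contains one of radius s/4 on which \<bar>a \<bullet> z\<bar> is at least \<bar>a\<bar> s/4,
  wherever its centre lies.\<close>

lemma nn_integral_abs_inner_ball_ge:
  fixes a w :: "'a::euclidean_space"
  assumes s: "s > 0"
  shows "ennreal (norm a * (s / 4) * (unit_ball_vol DIM('a) * (s / 4) ^ DIM('a))) \<le>
    (\<integral>\<^sup>+z. ennreal \<bar>a \<bullet> z\<bar> * indicator (ball w s) z \<partial>lborel)"
proof (cases "a = 0")
  case False
  \<comment> \<open>The centre is moved by s/2 along a or -a, with the sign of a \<bullet> w, so
    that the two contributions to a \<bullet> v add up instead of cancelling.\<close>
  define \<sigma> :: real where "\<sigma> = (if a \<bullet> w \<ge> 0 then 1 else - 1)"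
  define v where "v = w + (\<sigma> * (s / 2) / norm a) *\<^sub>R a"
  have bound: "norm a * (s / 4) \<le> \<bar>a \<bullet> z\<bar> \<and> z \<in> ball w s" if "z \<in> ball v (s / 4)" for z
  proof -
    define y where "y = z - v"
    have y: "norm y < s / 4" and z: "z = v + y"
      using that by (auto simp: y_def dist_norm norm_minus_commute)
    have vw: "norm (v - w) = s / 2"
      using False s by (simp add: v_def \<sigma>_def)
    have "\<sigma> * (a \<bullet> v) = \<bar>a \<bullet> w\<bar> + norm a * (s / 2)"
      using False by (simp add: v_def \<sigma>_def inner_add_right dot_square_norm power2_eq_square)
    moreover have "\<sigma> * (a \<bullet> v) \<le> \<bar>a \<bullet> v\<bar>" by (auto simp: \<sigma>_def)
    ultimately have "norm a * (s / 2) \<le> \<bar>a \<bullet> v\<bar>" by linarith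
    moreover have "\<bar>a \<bullet> y\<bar> \<le> norm a * (s / 4)"
      using Cauchy_Schwarz_ineq2[of a y] mult_left_mono[of "norm y" "s / 4" "norm a"] y by simp
    moreover have "\<bar>a \<bullet> v\<bar> \<le> \<bar>a \<bullet> z\<bar> + \<bar>a \<bullet> y\<bar>" by (simp add: z inner_add_right)
    moreover have "dist w z \<le> norm (v - w) + norm y"
      using norm_triangle_ineq[of "v - w" y] by (simp add: z dist_norm norm_minus_commute algebra_simps)
    ultimately show ?thesis using y vw s by (auto simp: field_simps)
  qed
  have "ennreal (norm a * (s / 4) * (unit_ball_vol DIM('a) * (s / 4) ^ DIM('a))) =
      ennreal (norm a * (s / 4)) * emeasure lborel (ball v (s / 4))"
    using s by (subst emeasure_ball, simp, intro ennreal_mult) auto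
  also have "\<dots> = (\<integral>\<^sup>+z. ennreal (norm a * (s / 4)) * indicator (ball v (s / 4)) z \<partial>lborel)"
    by (simp add: nn_integral_cmult_indicator)
  also have "\<dots> \<le> (\<integral>\<^sup>+z. ennreal \<bar>a \<bullet> z\<bar> * indicator (ball w s) z \<partial>lborel)"
    using bound by (intro nn_integral_mono) (auto simp: indicator_def intro!: ennreal_leI)
  finally show ?thesis .
qed simp

text \<open>The segment bound is integrated over the displacements w in
  \<open>ball (z - x) (\<kappa> * r)\<close>, for which x + w avoids \<open>\<Omega>\<close> and
  \<bar>w\<bar> < 2r.\<close>

lemma test_field_le_riesz_potential:
  fixes \<phi> :: "real^'n \<Rightarrow> real^'n"
  assumes d: "CARD('n) = Suc (Suc m)" and \<phi>: "\<phi> \<in> test_fields \<Omega>"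
    and \<kappa>: "\<kappa> > 0" and r: "r > 0" and sub: "ball z (\<kappa> * r) \<subseteq> ball x (2 * r) - \<Omega>"
  shows "ennreal (norm (\<phi> x)) \<le> ennreal ((8 / \<kappa>) ^ Suc (Suc (Suc m)) / (Suc m * unit_ball_vol (Suc (Suc m)))) *
     (\<integral>\<^sup>+y. ennreal (norm (classical_symgrad \<phi> y) / norm (x - y) ^ Suc m) * indicator (ball x (2 * r)) y \<partial>lborel)"
proof -
  define f where "f y = ennreal (norm (classical_symgrad \<phi> y))" for y
  have [measurable]: "f \<in> borel_measurable borel"
    unfolding f_def using classical_symgrad_continuous[OF \<phi>]
    by (intro measurable_compose[OF _ measurable_ennreal] borel_measurable_continuous_onI continuous_intros) auto
  have [measurable]: "ball c \<rho> \<in> sets borel" for c :: "real^'n" and \<rho> by simp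
  define I where "I = (\<integral>\<^sup>+y. f y * ennreal (1 / norm (x - y) ^ Suc m) * indicator (ball x (2 * r)) y \<partial>lborel)"
  define \<omega> where "\<omega> = unit_ball_vol (real (Suc (Suc m)))"
  have \<omega>: "\<omega> > 0" unfolding \<omega>_def by (rule unit_ball_vol_pos) simp
  \<comment> \<open>A is the factor from the lower bound for the average of \<bar>\<phi> x \<bullet>
    w\<bar>, and B is the factor from the upper bound. Both are multiples of r^(m+3), so r cancels
    in B/A and the constant depends only on the dimension and \<kappa>.\<close>
  define A where "A = \<kappa> * r / 4 * (\<omega> * (\<kappa> * r / 4) ^ Suc (Suc m))"
  define B where "B = (2 * r)\<^sup>2 * ((2 * r) ^ Suc m / Suc m)"
  have A: "A > 0" using \<kappa> r \<omega> by (simp add: A_def)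
  have "ennreal (norm (\<phi> x)) * ennreal A = ennreal (norm (\<phi> x) * (\<kappa> * r / 4) * (\<omega> * (\<kappa> * r / 4) ^ Suc (Suc m)))"
    using A by (subst ennreal_mult[symmetric]) (auto simp: A_def mult.assoc)
  also have "\<dots> \<le> (\<integral>\<^sup>+w. ennreal \<bar>\<phi> x \<bullet> w\<bar> * indicator (ball (z - x) (\<kappa> * r)) w \<partial>lborel)"
    using nn_integral_abs_inner_ball_ge[of "\<kappa> * r" "\<phi> x" "z - x"] \<kappa> r by (simp add: d \<omega>_def)
  also have "\<dots> \<le> (\<integral>\<^sup>+w. ennreal ((2 * r)\<^sup>2) * ((\<integral>\<^sup>+t. f (x + t *\<^sub>R w) * indicator {0..1} t \<partial>lborel) * indicator (ball 0 (2 * r)) w) \<partial>lborel)"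
  proof (rule nn_integral_mono)
    fix w :: "real^'n"
    show "ennreal \<bar>\<phi> x \<bullet> w\<bar> * indicator (ball (z - x) (\<kappa> * r)) w \<le>
      ennreal ((2 * r)\<^sup>2) * ((\<integral>\<^sup>+t. f (x + t *\<^sub>R w) * indicator {0..1} t \<partial>lborel) * indicator (ball 0 (2 * r)) w)"
    proof (cases "w \<in> ball (z - x) (\<kappa> * r)")
      case True
      then have "x + w \<in> ball z (\<kappa> * r)" by (simp add: dist_norm algebra_simps)
      then have w: "x + w \<notin> \<Omega>" "norm w < 2 * r" using sub by (auto simp: dist_norm)
      have "ennreal \<bar>\<phi> x \<bullet> w\<bar> \<le> ennreal ((norm w)\<^sup>2) * (\<integral>\<^sup>+t. f (x + t *\<^sub>R w) * indicator {0..1} t \<partial>lborel)"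
        unfolding f_def by (rule test_field_segment_bound[OF \<phi> w(1)])
      also have "\<dots> \<le> ennreal ((2 * r)\<^sup>2) * (\<integral>\<^sup>+t. f (x + t *\<^sub>R w) * indicator {0..1} t \<partial>lborel)"
        using w(2) by (intro mult_right_mono ennreal_leI power_mono) auto
      finally show ?thesis using True w(2) by simp
    qed simp
  qed
  also have "\<dots> = ennreal ((2 * r)\<^sup>2) * (\<integral>\<^sup>+w. (\<integral>\<^sup>+t. f (x + t *\<^sub>R w) * indicator {0..1} t \<partial>lborel) * indicator (ball 0 (2 * r)) w \<partial>lborel)"
    by (rule nn_integral_cmult) measurable
  also have "\<dots> \<le> ennreal ((2 * r)\<^sup>2) * (ennreal ((2 * r) ^ Suc m / Suc m) * I)"
    unfolding I_def using r d by (intro mult_left_mono nn_integral_segments_le_riesz_potential) auto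
  also have "\<dots> = ennreal B * I"
  proof -
    have "ennreal B = ennreal ((2 * r)\<^sup>2) * ennreal ((2 * r) ^ Suc m / Suc m)"
      unfolding B_def using r by (intro ennreal_mult) auto
    then show ?thesis by (simp only: mult.assoc)
  qed
  finally have *: "ennreal (norm (\<phi> x)) * ennreal A \<le> ennreal B * I" .
  have "ennreal (norm (\<phi> x)) = ennreal (inverse A) * (ennreal (norm (\<phi> x)) * ennreal A)"
    using A by (simp add: ennreal_mult[symmetric])
  also have "\<dots> \<le> ennreal (inverse A) * (ennreal B * I)" using * by (rule mult_left_mono) simp
  also have "\<dots> = ennreal (inverse A * B) * I"
    using A r by (subst ennreal_mult) (auto simp: B_def mult.assoc)
  also have "inverse A * B = (8 / \<kappa>) ^ Suc (Suc (Suc m)) / (Suc m * \<omega>)"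
  proof -
    have "(8::real) ^ m = 2 ^ m * 4 ^ m" by (simp add: power_mult_distrib[symmetric])
    then show ?thesis
      using \<kappa> r \<omega> by (simp add: A_def B_def power_mult_distrib power_divide power2_eq_square divide_simps del: of_nat_Suc)
  qed
  also have "I = (\<integral>\<^sup>+y. ennreal (norm (classical_symgrad \<phi> y) / norm (x - y) ^ Suc m) * indicator (ball x (2 * r)) y \<partial>lborel)"
    unfolding I_def f_def by (intro nn_integral_cong) (simp add: ennreal_mult[symmetric])
  finally show ?thesis by (simp only: \<omega>_def)
qed

section \<open>Passage to the limit\<close>

text \<open>A replacement for polar coordinates: \<rho>^(-m) is at most 2^(m+1) times the integral
  of t^(-m-1) over [\<rho>, 2 \<rho>]. After exchanging integrals, the volume of a ball of radius t
  cancels t^(-m-1), leaving a constant on [0, 2R].\<close>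

lemma nn_integral_riesz_kernel_ball:
  fixes y :: "'a::euclidean_space"
  assumes d: "DIM('a) = Suc m" and R: "R > 0"
  shows "(\<integral>\<^sup>+x. ennreal (1 / norm (x - y) ^ m) * indicator (ball y R) x \<partial>lborel) \<le>
    ennreal (2 ^ Suc m * (unit_ball_vol (Suc m) * (2 * R)))"
proof -
  define k :: "'a \<Rightarrow> real \<Rightarrow> ennreal" where
    "k x t = ennreal (inverse (t ^ Suc m)) * (if 0 < t \<and> t \<le> 2 * R \<and> dist y x \<le> t then 1 else 0)" for x t
  have [measurable]: "(\<lambda>p. k (fst p) (snd p)) \<in> borel_measurable (borel \<Otimes>\<^sub>M borel)"
    "(\<lambda>p. k (snd p) (fst p)) \<in> borel_measurable (borel \<Otimes>\<^sub>M borel)"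
    "(\<lambda>t. k x t) \<in> borel_measurable borel" "(\<lambda>x. k x t) \<in> borel_measurable borel" for x t
    unfolding k_def by measurable
  have "(\<integral>\<^sup>+x. ennreal (1 / norm (x - y) ^ m) * indicator (ball y R) x \<partial>lborel) \<le>
     (\<integral>\<^sup>+x. ennreal (2 ^ Suc m) * (\<integral>\<^sup>+t. k x t \<partial>lborel) \<partial>lborel)"
  proof (rule nn_integral_mono_AE, use AE_lborel_singleton[of y] in eventually_elim)
    fix x :: 'a assume "x \<noteq> y"
    define \<rho> where "\<rho> = norm (x - y)"
    have \<rho>: "\<rho> > 0" using \<open>x \<noteq> y\<close> by (simp add: \<rho>_def)
    show "ennreal (1 / norm (x - y) ^ m) * indicator (ball y R) x \<le> ennreal (2 ^ Suc m) * (\<integral>\<^sup>+t. k x t \<partial>lborel)"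
    proof (cases "x \<in> ball y R")
      case True
      have dx: "dist y x = \<rho>" by (simp add: \<rho>_def dist_norm norm_minus_commute)
      with True have R': "\<rho> < R" by simp
      \<comment> \<open>The right-hand side is 2^(m+1) times the length \<rho> of [\<rho>, 2 \<rho>]
        times the minimum of t^(-m-1) there.\<close>
      have "1 / \<rho> ^ m = 2 ^ Suc m * (inverse ((2 * \<rho>) ^ Suc m) * \<rho>)"
        using \<rho> by (simp add: power_mult_distrib field_simps)
      then have "ennreal (1 / \<rho> ^ m) = ennreal (2 ^ Suc m) * (ennreal (inverse ((2 * \<rho>) ^ Suc m)) * ennreal \<rho>)"
        using \<rho> by (simp add: ennreal_mult[symmetric] del: power_Suc)
      also have "ennreal (inverse ((2 * \<rho>) ^ Suc m)) * ennreal \<rho> =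
          (\<integral>\<^sup>+t. ennreal (inverse ((2 * \<rho>) ^ Suc m)) * indicator {\<rho>..2 * \<rho>} t \<partial>lborel)"
        using \<rho> by (simp add: nn_integral_cmult_indicator del: power_Suc)
      also have "\<dots> \<le> (\<integral>\<^sup>+t. k x t \<partial>lborel)"
      proof (rule nn_integral_mono)
        fix t :: real
        have "inverse ((2 * \<rho>) ^ Suc m) \<le> inverse (t ^ Suc m) \<and> 0 < t" if "\<rho> \<le> t" "t \<le> 2 * \<rho>"
          using that \<rho> by (intro conjI le_imp_inverse_le power_mono zero_less_power) auto
        then show "ennreal (inverse ((2 * \<rho>) ^ Suc m)) * indicator {\<rho>..2 * \<rho>} t \<le> k x t"
          using R' by (auto simp: k_def dx indicator_def intro!: ennreal_leI simp del: power_Suc)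
      qed
      finally show ?thesis using True by (simp add: \<rho>_def mult_left_mono)
    qed simp
  qed
  also have "\<dots> = ennreal (2 ^ Suc m) * (\<integral>\<^sup>+x. (\<integral>\<^sup>+t. k x t \<partial>lborel) \<partial>lborel)"
    by (rule nn_integral_cmult) measurable
  also have "(\<integral>\<^sup>+x. (\<integral>\<^sup>+t. k x t \<partial>lborel) \<partial>lborel) = (\<integral>\<^sup>+t. (\<integral>\<^sup>+x. k x t \<partial>lborel) \<partial>lborel)"
    by (rule lborel_pair.Fubini'[symmetric]) (simp add: split_beta')
  also have "\<dots> \<le> (\<integral>\<^sup>+t. ennreal (unit_ball_vol (Suc m)) * indicator {0..2 * R} t \<partial>lborel)"
  proof (rule nn_integral_mono)
    fix t :: real
    show "(\<integral>\<^sup>+x. k x t \<partial>lborel) \<le> ennreal (unit_ball_vol (Suc m)) * indicator {0..2 * R} t"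
    proof (cases "0 < t \<and> t \<le> 2 * R")
      case True
      then have "(\<integral>\<^sup>+x. k x t \<partial>lborel) = (\<integral>\<^sup>+x. ennreal (inverse (t ^ Suc m)) * indicator (cball y t) x \<partial>lborel)"
        by (intro nn_integral_cong) (auto simp: k_def indicator_def)
      also have "\<dots> = ennreal (inverse (t ^ Suc m)) * emeasure lborel (cball y t)"
        by (simp add: nn_integral_cmult_indicator)
      also have "\<dots> = ennreal (inverse (t ^ Suc m) * (unit_ball_vol (Suc m) * t ^ Suc m))"
        using True by (subst emeasure_cball) (auto simp: d ennreal_mult simp del: power_Suc)
      also have "inverse (t ^ Suc m) * (unit_ball_vol (Suc m) * t ^ Suc m) = unit_ball_vol (Suc m)"
        using True by (simp add: field_simps)
      finally show ?thesis using True by simp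
    qed (auto simp: k_def)
  qed
  also have "\<dots> = ennreal (unit_ball_vol (Suc m) * (2 * R))"
    using R by (simp add: nn_integral_cmult_indicator ennreal_mult)
  finally show ?thesis
    using R by (subst ennreal_mult) (auto simp: mult_left_mono)
qed

text \<open>Tonelli puts the outer integral on the kernel, whose integral over
  \<open>\<Omega>\<close> is bounded uniformly in y. The constant C is chosen before g.\<close>

lemma nn_integral_riesz_potential_le:
  fixes \<Omega> :: "'a::euclidean_space set"
  assumes d: "DIM('a) = Suc m" and [measurable]: "\<Omega> \<in> sets borel" and "bounded \<Omega>"
  shows "\<exists>C. \<forall>g \<in> borel_measurable borel.
    (\<integral>\<^sup>+x. (\<integral>\<^sup>+y. g y * ennreal (1 / norm (x - y) ^ m) * indicator \<Omega> y \<partial>lborel) * indicator \<Omega> x \<partial>lborel) \<le>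
    ennreal C * (\<integral>\<^sup>+y. g y \<partial>lborel)"
proof -
  have [measurable]: "ball c \<rho> \<in> sets borel" for c :: 'a and \<rho> by simp
  obtain R where R: "\<And>x. x \<in> \<Omega> \<Longrightarrow> norm x \<le> R" "R > 0"
    using \<open>bounded \<Omega>\<close> by (auto simp: bounded_pos)
  \<comment> \<open>Two points of \<open>\<Omega>\<close> are at most 2R apart, so the open ball of
    radius 3R about either one contains \<open>\<Omega>\<close>.\<close>
  define C where "C = 2 ^ Suc m * (unit_ball_vol (Suc m) * (2 * (3 * R)))"
  have "(\<integral>\<^sup>+x. (\<integral>\<^sup>+y. g y * ennreal (1 / norm (x - y) ^ m) * indicator \<Omega> y \<partial>lborel) * indicator \<Omega> x \<partial>lborel) \<le>
    ennreal C * (\<integral>\<^sup>+y. g y \<partial>lborel)" if [measurable]: "g \<in> borel_measurable borel" for g :: "'a \<Rightarrow> ennreal"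
  proof -
    have "(\<integral>\<^sup>+x. (\<integral>\<^sup>+y. g y * ennreal (1 / norm (x - y) ^ m) * indicator \<Omega> y \<partial>lborel) * indicator \<Omega> x \<partial>lborel) =
       (\<integral>\<^sup>+x. (\<integral>\<^sup>+y. g y * ennreal (1 / norm (x - y) ^ m) * indicator \<Omega> y * indicator \<Omega> x \<partial>lborel) \<partial>lborel)"
      by (simp add: nn_integral_multc)
    also have "\<dots> = (\<integral>\<^sup>+y. (\<integral>\<^sup>+x. g y * ennreal (1 / norm (x - y) ^ m) * indicator \<Omega> y * indicator \<Omega> x \<partial>lborel) \<partial>lborel)"
      by (rule lborel_pair.Fubini'[symmetric]) measurable
    also have "\<dots> \<le> (\<integral>\<^sup>+y. ennreal C * g y \<partial>lborel)"
    proof (rule nn_integral_mono)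
      fix y :: 'a
      show "(\<integral>\<^sup>+x. g y * ennreal (1 / norm (x - y) ^ m) * indicator \<Omega> y * indicator \<Omega> x \<partial>lborel) \<le> ennreal C * g y"
      proof (cases "y \<in> \<Omega>")
        case True
        have "x \<in> ball y (3 * R)" if "x \<in> \<Omega>" for x
          using R(1)[OF that] R(1)[OF True] R(2) norm_triangle_ineq4[of y x] by (simp add: dist_norm)
        then have "(\<integral>\<^sup>+x. g y * ennreal (1 / norm (x - y) ^ m) * indicator \<Omega> y * indicator \<Omega> x \<partial>lborel) \<le>
           (\<integral>\<^sup>+x. g y * (ennreal (1 / norm (x - y) ^ m) * indicator (ball y (3 * R)) x) \<partial>lborel)"
          by (intro nn_integral_mono) (auto simp: indicator_def)
        also have "\<dots> = g y * (\<integral>\<^sup>+x. ennreal (1 / norm (x - y) ^ m) * indicator (ball y (3 * R)) x \<partial>lborel)"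
          by (rule nn_integral_cmult) measurable
        also have "\<dots> \<le> g y * ennreal C"
          unfolding C_def using R(2) by (intro mult_left_mono nn_integral_riesz_kernel_ball d) auto
        finally show ?thesis by (simp add: mult.commute)
      qed simp
    qed
    also have "\<dots> = ennreal C * (\<integral>\<^sup>+y. g y \<partial>lborel)"
      by (rule nn_integral_cmult) measurable
    finally show ?thesis .
  qed
  then show ?thesis by blast
qed

text \<open>Tonelli is applied to Borel functions over \<open>lborel\<close>, while f is only
  Lebesgue measurable on \<open>\<Omega>\<close>; a Borel function equal to the norm almost
  everywhere takes its place.\<close>

lemma ex_borel_norm:
  fixes f :: "'a::euclidean_space \<Rightarrow> 'b::euclidean_space"
  assumes f: "integrable (lebesgue_on \<Omega>) f" and [measurable]: "\<Omega> \<in> sets borel"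
  shows "\<exists>g \<in> borel_measurable borel. (AE y in lborel. ennreal (norm (f y)) * indicator \<Omega> y = g y) \<and>
     (\<integral>\<^sup>+y. g y \<partial>lborel) = ennreal (LINT y|lebesgue_on \<Omega>. norm (f y))"
proof -
  have "(\<lambda>y. ennreal (norm (f y))) \<in> borel_measurable (lebesgue_on \<Omega>)" using f by simp
  then have "(\<lambda>y. ennreal (norm (f y)) * indicator \<Omega> y) \<in> borel_measurable lebesgue"
    by (subst (asm) borel_measurable_restrict_space_iff_ennreal) auto
  then obtain g where g: "g \<in> borel_measurable lborel" "AE y in lborel. ennreal (norm (f y)) * indicator \<Omega> y = g y"
    using completion_ex_borel_measurable by blast
  have "(\<integral>\<^sup>+y. g y \<partial>lborel) = (\<integral>\<^sup>+y. ennreal (norm (f y)) * indicator \<Omega> y \<partial>lborel)"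
    by (rule nn_integral_cong_AE) (use g(2) in eventually_elim, simp)
  also have "\<dots> = (\<integral>\<^sup>+y. ennreal (norm (f y)) \<partial>lebesgue_on \<Omega>)"
    by (simp add: nn_integral_restrict_space nn_integral_completion)
  also have "\<dots> = ennreal (LINT y|lebesgue_on \<Omega>. norm (f y))"
    using f by (intro nn_integral_eq_integral) auto
  finally show ?thesis using g by auto
qed

text \<open>Valid for arbitrary f, because the nonnegative integral is unchanged by completion of
  the measure.\<close>

lemma nn_integral_lebesgue_on_norm_quotient:
  assumes [measurable]: "S \<in> sets borel"
  shows "(\<integral>\<^sup>+y. ennreal (norm (f y) / norm (x - y) ^ m) \<partial>lebesgue_on S) =
    (\<integral>\<^sup>+y. ennreal (norm (f y)) * ennreal (1 / norm (x - y) ^ m) * indicator S y \<partial>lborel)"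
proof -
  have "ennreal (norm (f y) / norm (x - y) ^ m) = ennreal (norm (f y)) * ennreal (1 / norm (x - y) ^ m)" for y
    by (simp add: ennreal_mult[symmetric])
  then show ?thesis by (simp add: nn_integral_restrict_space nn_integral_completion)
qed

text \<open>Test fields \<phi> k approximate u, and the error in the pointwise inequality is
  dominated by a function whose integral tends to 0. The predicate P and the radius \<rho> are kept
  abstract; they enter only through the estimate for test fields.\<close>

lemma X11_riesz_estimate:
  fixes \<Omega> :: "(real^'n) set"
  assumes d: "CARD('n) = Suc m" and \<Omega>: "open \<Omega>" "bounded \<Omega>"
    and test: "\<And>\<phi> x. \<phi> \<in> test_fields \<Omega> \<Longrightarrow> x \<in> \<Omega> \<Longrightarrow> P x \<Longrightarrow>
        ennreal (norm (\<phi> x)) \<le> ennreal c0 *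
          (\<integral>\<^sup>+y. ennreal (norm (classical_symgrad \<phi> y) / norm (x - y) ^ m) \<partial>lebesgue_on (ball x (\<rho> x) \<inter> \<Omega>))"
    and u: "u \<in> X11 \<Omega>"
  shows "AE x in lebesgue_on \<Omega>. P x \<longrightarrow> ennreal (norm (u x)) \<le> ennreal c0 *
          (\<integral>\<^sup>+y. ennreal (norm (symgrad \<Omega> u y) / norm (x - y) ^ m) \<partial>lebesgue_on (ball x (\<rho> x) \<inter> \<Omega>))"
proof -
  have [measurable]: "\<Omega> \<in> sets borel" using \<Omega> by simp
  have uE: "u \<in> E11 \<Omega>" using u by (simp add: X11_def)
  have "\<exists>\<phi>\<in>test_fields \<Omega>. E11_norm \<Omega> (\<lambda>x. u x - \<phi> x) < inverse (Suc k)" for k :: nat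
    using u by (simp add: X11_def)
  then obtain \<phi> where \<phi>: "\<And>k. \<phi> k \<in> test_fields \<Omega>"
    and small: "\<And>k. E11_norm \<Omega> (\<lambda>x. u x - \<phi> k x) < inverse (Suc k)" by metis
  define v where "v k x = u x - \<phi> k x" for k x
  have vE: "v k \<in> E11 \<Omega>" for k
    unfolding v_def by (rule E11_diff_test_field[OF \<Omega>(1) uE \<phi>])
  have vi: "integrable (lebesgue_on \<Omega>) (v k)" for k using vE by (simp add: E11_def)
  have gi: "integrable (lebesgue_on \<Omega>) (symgrad \<Omega> w)" if "w \<in> E11 \<Omega>" for w
    using E11_symgrad[OF that] by (simp add: has_symgrad_def)
  have "\<exists>h. \<forall>k. h k \<in> borel_measurable borel \<and> (AE y in lborel. ennreal (norm (v k y)) * indicator \<Omega> y = h k y) \<and>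
      (\<integral>\<^sup>+y. h k y \<partial>lborel) = ennreal (LINT y|lebesgue_on \<Omega>. norm (v k y))"
    using ex_borel_norm[OF vi] by (intro choice allI) (simp add: Bex_def)
  then obtain h where h[measurable]: "\<And>k. h k \<in> borel_measurable borel"
    and h_ae: "\<And>k. AE y in lborel. ennreal (norm (v k y)) * indicator \<Omega> y = h k y"
    and h_int: "\<And>k. (\<integral>\<^sup>+y. h k y \<partial>lborel) = ennreal (LINT y|lebesgue_on \<Omega>. norm (v k y))"
    by blast
  have "\<exists>g. \<forall>k. g k \<in> borel_measurable borel \<and> (AE y in lborel. ennreal (norm (symgrad \<Omega> (v k) y)) * indicator \<Omega> y = g k y) \<and>
      (\<integral>\<^sup>+y. g k y \<partial>lborel) = ennreal (LINT y|lebesgue_on \<Omega>. norm (symgrad \<Omega> (v k) y))"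
    using ex_borel_norm[OF gi[OF vE]] by (intro choice allI) (simp add: Bex_def)
  then obtain g where g[measurable]: "\<And>k. g k \<in> borel_measurable borel"
    and g_ae: "\<And>k. AE y in lborel. ennreal (norm (symgrad \<Omega> (v k) y)) * indicator \<Omega> y = g k y"
    and g_int: "\<And>k. (\<integral>\<^sup>+y. g k y \<partial>lborel) = ennreal (LINT y|lebesgue_on \<Omega>. norm (symgrad \<Omega> (v k) y))"
    by blast
  obtain s where s[measurable]: "s \<in> borel_measurable borel"
    and s_ae: "AE y in lborel. ennreal (norm (symgrad \<Omega> u y)) * indicator \<Omega> y = s y"
    using ex_borel_norm[OF gi[OF uE] \<open>\<Omega> \<in> sets borel\<close>] by blast
  obtain C where C: "\<And>g. g \<in> borel_measurable borel \<Longrightarrow>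
    (\<integral>\<^sup>+x. (\<integral>\<^sup>+y. g y * ennreal (1 / norm (x - y) ^ m) * indicator \<Omega> y \<partial>lborel) * indicator \<Omega> x \<partial>lborel) \<le>
    ennreal C * (\<integral>\<^sup>+y. g y \<partial>lborel)"
    using nn_integral_riesz_potential_le[of m \<Omega>] d \<Omega>(2) by auto
  \<comment> \<open>The total error at x: the norm of u - \<phi> k plus c0 times the Riesz potential
    of its symmetric gradient, both through Borel representatives.\<close>
  define F where "F k x = h k x * indicator \<Omega> x +
     ennreal c0 * ((\<integral>\<^sup>+y. g k y * ennreal (1 / norm (x - y) ^ m) * indicator \<Omega> y \<partial>lborel) * indicator \<Omega> x)" for k x
  have [measurable]: "F k \<in> borel_measurable borel" for k unfolding F_def by measurable
  have F_int: "(\<integral>\<^sup>+x. F k x \<partial>lborel) \<le> (1 + ennreal c0 * ennreal C) * ennreal (inverse (Suc k))" for k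
  proof -
    have "E11_norm \<Omega> (v k) < inverse (Suc k)" unfolding v_def by (rule small)
    then have "(LINT y|lebesgue_on \<Omega>. norm (v k y)) + (LINT y|lebesgue_on \<Omega>. norm (symgrad \<Omega> (v k) y)) \<le> inverse (Suc k)"
      by (simp add: E11_norm_def)
    moreover have "0 \<le> (LINT y|lebesgue_on \<Omega>. norm (v k y))" "0 \<le> (LINT y|lebesgue_on \<Omega>. norm (symgrad \<Omega> (v k) y))"
      by simp_all
    ultimately have "(LINT y|lebesgue_on \<Omega>. norm (v k y)) \<le> inverse (Suc k)"
      "(LINT y|lebesgue_on \<Omega>. norm (symgrad \<Omega> (v k) y)) \<le> inverse (Suc k)"
      by linarith+
    then have le: "(\<integral>\<^sup>+y. h k y \<partial>lborel) \<le> ennreal (inverse (Suc k))" "(\<integral>\<^sup>+y. g k y \<partial>lborel) \<le> ennreal (inverse (Suc k))"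
      unfolding h_int g_int by (auto intro!: ennreal_leI)
    have "(\<integral>\<^sup>+x. F k x \<partial>lborel) = (\<integral>\<^sup>+x. h k x * indicator \<Omega> x \<partial>lborel) +
       ennreal c0 * (\<integral>\<^sup>+x. (\<integral>\<^sup>+y. g k y * ennreal (1 / norm (x - y) ^ m) * indicator \<Omega> y \<partial>lborel) * indicator \<Omega> x \<partial>lborel)"
      unfolding F_def by (subst nn_integral_add) (auto simp: nn_integral_cmult)
    also have "\<dots> \<le> ennreal (inverse (Suc k)) + ennreal c0 * (ennreal C * ennreal (inverse (Suc k)))"
    proof (intro add_mono mult_left_mono)
      have "(\<integral>\<^sup>+x. h k x * indicator \<Omega> x \<partial>lborel) \<le> (\<integral>\<^sup>+x. h k x \<partial>lborel)"
        by (intro nn_integral_mono) (auto simp: indicator_def)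
      with le(1) show "(\<integral>\<^sup>+x. h k x * indicator \<Omega> x \<partial>lborel) \<le> ennreal (inverse (Suc k))" by (rule order_trans[rotated])
      show "(\<integral>\<^sup>+x. (\<integral>\<^sup>+y. g k y * ennreal (1 / norm (x - y) ^ m) * indicator \<Omega> y \<partial>lborel) * indicator \<Omega> x \<partial>lborel) \<le>
          ennreal C * ennreal (inverse (Suc k))"
        by (rule order_trans[OF C[OF g] mult_left_mono[OF le(2)]]) simp
    qed simp
    also have "\<dots> = (1 + ennreal c0 * ennreal C) * ennreal (inverse (Suc k))"
      by (simp add: distrib_right mult.assoc)
    finally show ?thesis .
  qed
  \<comment> \<open>The integral of the infimum is below every bound for \<open>F k\<close>, hence
    zero. Using the infimum avoids extracting a subsequence that converges almost
    everywhere.\<close>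
  have "AE x in lborel. (INF k. F k x) = 0"
  proof -
    have "(\<integral>\<^sup>+x. (INF k. F k x) \<partial>lborel) \<le> (1 + ennreal c0 * ennreal C) * ennreal (inverse (Suc k))" for k
      by (rule order_trans[OF nn_integral_mono F_int]) (auto intro: INF_lower)
    moreover have "(\<lambda>k. (1 + ennreal c0 * ennreal C) * ennreal (inverse (Suc k))) \<longlonglongrightarrow> (1 + ennreal c0 * ennreal C) * ennreal 0"
      by (intro ennreal_tendsto_cmult tendsto_ennrealI LIMSEQ_inverse_real_of_nat)
         (simp add: ennreal_mult_less_top)
    ultimately have "(\<integral>\<^sup>+x. (INF k. F k x) \<partial>lborel) \<le> (1 + ennreal c0 * ennreal C) * ennreal 0"
      by (intro LIMSEQ_le_const) auto
    then show ?thesis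
      by (subst (asm) (1) ennreal_0, subst nn_integral_0_iff_AE[symmetric]) auto
  qed
  moreover have "AE x in lborel. \<forall>k. ennreal (norm (v k x)) * indicator \<Omega> x = h k x"
    using h_ae by (simp add: AE_all_countable)
  ultimately have "AE x in lborel. x \<in> \<Omega> \<longrightarrow> P x \<longrightarrow> ennreal (norm (u x)) \<le> ennreal c0 *
          (\<integral>\<^sup>+y. ennreal (norm (symgrad \<Omega> u y) / norm (x - y) ^ m) \<partial>lebesgue_on (ball x (\<rho> x) \<inter> \<Omega>))"
  proof eventually_elim
    case (elim x)
    show ?case
    proof (intro impI)
      assume x: "x \<in> \<Omega>" "P x"
      let ?B = "ball x (\<rho> x) \<inter> \<Omega>"
      let ?K = "\<lambda>y. ennreal (1 / norm (x - y) ^ m)"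
      have [measurable]: "?B \<in> sets borel" by simp
      define I where "I = (\<integral>\<^sup>+y. ennreal (norm (symgrad \<Omega> u y) / norm (x - y) ^ m) \<partial>lebesgue_on ?B)"
      have I: "I = (\<integral>\<^sup>+y. s y * ?K y * indicator ?B y \<partial>lborel)"
        unfolding I_def nn_integral_lebesgue_on_norm_quotient[OF \<open>?B \<in> sets borel\<close>]
        by (rule nn_integral_cong_AE) (use s_ae in eventually_elim, auto simp: indicator_def)
      have "ennreal (norm (u x)) \<le> F k x + ennreal c0 * I" for k
      proof -
        \<comment> \<open>The triangle inequality bounds the symmetric gradient of \<phi> k by those
          of u and v k. The v k term is enlarged from the ball to all of \<open>\<Omega>\<close>, so
          that it becomes the potential in \<open>F k\<close>.\<close>
        have "AE y in lebesgue_on \<Omega>. symgrad \<Omega> (v k) y = symgrad \<Omega> u y - classical_symgrad (\<phi> k) y"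
          unfolding v_def by (rule symgrad_diff_test_field[OF \<Omega>(1) uE \<phi>])
        then have "AE y in lborel. y \<in> \<Omega> \<longrightarrow> symgrad \<Omega> (v k) y = symgrad \<Omega> u y - classical_symgrad (\<phi> k) y"
          by (subst (asm) AE_restrict_space_iff) (auto simp: AE_completion_iff)
        then have ae: "AE y in lborel. ennreal (norm (classical_symgrad (\<phi> k) y)) * ?K y * indicator ?B y \<le>
            s y * ?K y * indicator ?B y + g k y * ?K y * indicator \<Omega> y"
          using s_ae g_ae[of k]
        proof eventually_elim
          case (elim y)
          show ?case
          proof (cases "y \<in> ?B")
            case True
            then have "norm (classical_symgrad (\<phi> k) y) \<le> norm (symgrad \<Omega> u y) + norm (symgrad \<Omega> (v k) y)"
              using elim(1) norm_triangle_ineq4[of "symgrad \<Omega> u y" "symgrad \<Omega> (v k) y"] by simp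
            moreover have sg: "s y = ennreal (norm (symgrad \<Omega> u y))" "g k y = ennreal (norm (symgrad \<Omega> (v k) y))"
              using elim(2,3) True by auto
            ultimately have "ennreal (norm (classical_symgrad (\<phi> k) y)) \<le> s y + g k y"
              unfolding sg by (subst ennreal_plus[symmetric]) (auto intro: ennreal_leI simp del: ennreal_plus)
            then have "ennreal (norm (classical_symgrad (\<phi> k) y)) * ?K y \<le> (s y + g k y) * ?K y"
              by (rule mult_right_mono) simp
            then show ?thesis using True by (simp add: distrib_right)
          qed simp
        qed
        have "ennreal (norm (\<phi> k x)) \<le> ennreal c0 * (\<integral>\<^sup>+y. ennreal (norm (classical_symgrad (\<phi> k) y)) * ?K y * indicator ?B y \<partial>lborel)"
          using test[OF \<phi> x, of k] by (simp only: nn_integral_lebesgue_on_norm_quotient[OF \<open>?B \<in> sets borel\<close>])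
        also have "\<dots> \<le> ennreal c0 * (\<integral>\<^sup>+y. s y * ?K y * indicator ?B y + g k y * ?K y * indicator \<Omega> y \<partial>lborel)"
          by (intro mult_left_mono nn_integral_mono_AE ae) simp
        also have "\<dots> = ennreal c0 * (\<integral>\<^sup>+y. g k y * ?K y * indicator \<Omega> y \<partial>lborel) + ennreal c0 * I"
          unfolding I by (subst nn_integral_add) (auto simp: distrib_left add.commute)
        finally have phi: "ennreal (norm (\<phi> k x)) \<le>
            ennreal c0 * (\<integral>\<^sup>+y. g k y * ?K y * indicator \<Omega> y \<partial>lborel) + ennreal c0 * I" .
        have "norm (u x) \<le> norm (v k x) + norm (\<phi> k x)"
          using norm_triangle_ineq[of "v k x" "\<phi> k x"] by (simp add: v_def)
        then have "ennreal (norm (u x)) \<le> ennreal (norm (v k x)) + ennreal (norm (\<phi> k x))"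
          by (simp flip: ennreal_plus add: ennreal_leI)
        also have "ennreal (norm (v k x)) = h k x" using elim(2) x(1) by (metis indicator_simps(1) mult.right_neutral)
        also have "h k x + ennreal (norm (\<phi> k x)) \<le> F k x + ennreal c0 * I"
          using phi x(1) by (simp add: F_def add.assoc add_left_mono)
        finally show ?thesis .
      qed
      \<comment> \<open>For this fixed x the bound holds for every k, and the infimum of
        \<open>F k x\<close> is 0.\<close>
      then have "ennreal (norm (u x)) \<le> (INF k. F k x + ennreal c0 * I)"
        by (intro INF_greatest)
      also have "\<dots> = ennreal c0 * I" using elim(1) by (simp add: INF_ennreal_add_const)
      finally show "ennreal (norm (u x)) \<le> ennreal c0 * (\<integral>\<^sup>+y. ennreal (norm (symgrad \<Omega> u y) / norm (x - y) ^ m) \<partial>lebesgue_on ?B)"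
        by (simp only: I_def)
    qed
  qed
  then show ?thesis
    by (subst AE_restrict_space_iff) (auto simp: AE_completion_iff)
qed

theorem theorem3p1:
  fixes \<Omega> :: "(real^'n) set"
  assumes "CARD('n) \<ge> 2"
    and "bounded_lipschitz_domain \<Omega>"
  shows "\<exists>c0 > 0. \<exists>h0 > 0. \<forall>u \<in> X11 \<Omega>. AE x in lebesgue_on \<Omega>.
           infdist x (frontier \<Omega>) \<le> h0 \<longrightarrow>
           ennreal (norm (u x)) \<le>
             ennreal c0 * (\<integral>\<^sup>+ y. ennreal (norm (symgrad \<Omega> u y) / norm (x - y) ^ (CARD('n) - 1))
                \<partial>lebesgue_on (ball x (2 * infdist x (frontier \<Omega>)) \<inter> \<Omega>))"
proof -
  \<comment> \<open>Writing d = m + 2 turns the exponent d - 1 into \<open>Suc m\<close> and makes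
    it positive.\<close>
  obtain m where m: "CARD('n) = Suc (Suc m)"
    using assms(1) by (metis Suc_le_D numeral_2_eq_2 Suc_le_mono)
  have \<Omega>: "open \<Omega>" "bounded \<Omega>" using assms(2) by (auto simp: bounded_lipschitz_domain_def)
  obtain \<kappa> h0 where \<kappa>: "\<kappa> > 0" and h0: "h0 > 0"
    and ext: "\<And>x. x \<in> \<Omega> \<Longrightarrow> infdist x (frontier \<Omega>) \<le> h0 \<Longrightarrow> 0 < infdist x (frontier \<Omega>) \<and>
     (\<exists>z. ball z (\<kappa> * infdist x (frontier \<Omega>)) \<subseteq> ball x (2 * infdist x (frontier \<Omega>)) - \<Omega>)"
    using bounded_lipschitz_domain_exterior_ball[OF assms(2)] by metis
  \<comment> \<open>The constant of the estimate for test fields; through \<kappa> it depends on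
    \<open>\<Omega>\<close>, and it does not involve u.\<close>
  define c0 where "c0 = (8 / \<kappa>) ^ Suc (Suc (Suc m)) / (Suc m * unit_ball_vol (Suc (Suc m)))"
  have c0: "c0 > 0"
    unfolding c0_def using \<kappa> by (intro divide_pos_pos mult_pos_pos zero_less_power unit_ball_vol_pos) auto
  have test: "ennreal (norm (\<phi> x)) \<le> ennreal c0 * (\<integral>\<^sup>+y. ennreal (norm (classical_symgrad \<phi> y) / norm (x - y) ^ Suc m)
      \<partial>lebesgue_on (ball x (2 * infdist x (frontier \<Omega>)) \<inter> \<Omega>))"
    if \<phi>: "\<phi> \<in> test_fields \<Omega>" and x: "x \<in> \<Omega>" "infdist x (frontier \<Omega>) \<le> h0" for \<phi> x
  proof -
    let ?r = "infdist x (frontier \<Omega>)"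
    obtain z where z: "ball z (\<kappa> * ?r) \<subseteq> ball x (2 * ?r) - \<Omega>" and r: "0 < ?r" using ext[OF x] by blast
    \<comment> \<open>Restricting the ball to \<open>\<Omega>\<close> loses nothing, since the
      symmetric gradient of a test field vanishes outside \<open>\<Omega>\<close>.\<close>
    have "(\<integral>\<^sup>+y. ennreal (norm (classical_symgrad \<phi> y) / norm (x - y) ^ Suc m) * indicator (ball x (2 * ?r)) y \<partial>lborel) =
       (\<integral>\<^sup>+y. ennreal (norm (classical_symgrad \<phi> y) / norm (x - y) ^ Suc m) * indicator (ball x (2 * ?r) \<inter> \<Omega>) y \<partial>lborel)"
      using classical_symgrad_eq_0[OF \<phi>] by (intro nn_integral_cong) (auto simp: indicator_def)
    also have "\<dots> = (\<integral>\<^sup>+y. ennreal (norm (classical_symgrad \<phi> y) / norm (x - y) ^ Suc m) \<partial>lebesgue_on (ball x (2 * ?r) \<inter> \<Omega>))"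
      using \<Omega>(1) by (simp add: nn_integral_restrict_space nn_integral_completion open_Int del: power_Suc)
    finally show ?thesis
      using test_field_le_riesz_potential[OF m \<phi> \<kappa> r z] by (simp only: c0_def)
  qed
  show ?thesis
  proof (rule exI[of _ c0], rule conjI[OF c0], rule exI[of _ h0], rule conjI[OF h0], rule ballI)
    fix u assume "u \<in> X11 \<Omega>"
    from X11_riesz_estimate[OF m \<Omega> test this]
    show "AE x in lebesgue_on \<Omega>. infdist x (frontier \<Omega>) \<le> h0 \<longrightarrow> ennreal (norm (u x)) \<le>
             ennreal c0 * (\<integral>\<^sup>+ y. ennreal (norm (symgrad \<Omega> u y) / norm (x - y) ^ (CARD('n) - 1))
                \<partial>lebesgue_on (ball x (2 * infdist x (frontier \<Omega>)) \<inter> \<Omega>))"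
      by (simp add: m)
  qed
qed

end
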